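(* For every integer $m\ge 2$ and every real $0<\varepsilon<1$, $$\max\Big\{m,\frac{m(m+1)(1-\varepsilon^2)}{2(1+m\varepsilon^2)}\Big\}\le \mathcal N(m,\varepsilon)\le \min\Big\{m^2,\frac{5m}{\varepsilon^2}\Big\}.$$ Moreover, $\mathcal N(m,0)=m^2$. Consequently, for every $m\ge 2$ and $0<\varepsilon<1$, $$\frac18\min\Big\{m^2,\frac{m}{\varepsilon^2}\Big\}\le \mathcal N(m,\varepsilon)\le 5\min\Big\{m^2,\frac{m}{\varepsilon^2}\Big\}.$$
   Context: Let $(\Omega,\nu)$ be a measure space and let $\mathcal F\subseteq L_2(\Omega,\nu)$ be an $m$-dimensional complex function space on which pointwise function evaluations are well-defined (i.e. the elements are genuine functions $\Omega\to\mathbb C$ and $\|\cdot\|_{L_2}$ is a norm on $\mathcal F$). For $0\le\varepsilon<1$, distinct points $x_1,\dots,x_n\in\Omega$ and positive weights $w_1,\dots,w_n>0$ satisfy the weighted $L_2$ Marcinkiewicz--Zygmund (MZ) inequality on $\mathcal F$ with distortion $\varepsilon$ if $$(1-\varepsilon)\|f\|_{L_2}^2\le\sum_{i=1}^n w_i|f(x_i)|^2\le(1+\varepsilon)\|f\|_{L_2}^2\quad\text{for all } f\in\mathcal F.$$ Write $\mathcal F\in\mathcal M_+^w(n,\varepsilon)$ if such points and weights exist. Define $$\mathcal N(m,\varepsilon)=\sup_{(\Omega,\nu),\,\mathcal F}\min\{n\in\mathbb N:\mathcal F\in\mathcal M_+^w(n,\varepsilon)\},$$ where the supremum is over all measure spaces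 $(\Omega,\nu)$ and all $m$-dimensional complex function spaces $\mathcal F\subseteq L_2(\Omega,\nu)$ on which pointwise function evaluations are well-defined (i.e. the elements are genuine functions $\Omega\to\mathbb C$ and $\|\cdot\|_{L_2}$ is a norm on $\mathcal F$). *)

theory Defs
  imports "HOL-Analysis.Analysis" "HOL-Library.Function_Algebras"
begin

text \<open>Complex-valued functions as a complex vector space under pointwise operations.
  Addition and zero on functions come from \<^theory>\<open>HOL-Library.Function_Algebras\<close>.\<close>

definition cfun_scale :: "complex \<Rightarrow> ('a \<Rightarrow> complex) \<Rightarrow> 'a \<Rightarrow> complex" where
  "cfun_scale c f = (\<lambda>x. c * f x)"

global_interpretation cfun: vector_space "cfun_scale :: complex \<Rightarrow> ('a \<Rightarrow> complex) \<Rightarrow> 'a \<Rightarrow> complex"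
  by unfold_locales (auto simp: cfun_scale_def fun_eq_iff algebra_simps)

definition square_integrable :: "'a measure \<Rightarrow> ('a \<Rightarrow> complex) \<Rightarrow> bool" where
  "square_integrable M f \<longleftrightarrow> f \<in> borel_measurable M \<and> integrable M (\<lambda>x. (cmod (f x))\<^sup>2)"

definition norm_L2 :: "'a measure \<Rightarrow> ('a \<Rightarrow> complex) \<Rightarrow> real" where
  "norm_L2 M f = sqrt (\<integral>x. (cmod (f x))\<^sup>2 \<partial>M)"

text \<open>The complex function spaces of dimension \<open>m\<close> in \<open>L\<^sub>2(\<Omega>, \<nu>)\<close> on which point evaluation
  is well-defined; \<open>M\<close> is the measure space and \<open>\<Omega> = space M\<close>.  A function from \<open>\<Omega>\<close> to the
  complex numbers is represented by its extension by zero to the whole type, so that equality of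
  functions is equality on \<open>\<Omega>\<close>.  Since \<^const>\<open>norm_L2\<close> is always a seminorm on square-integrable
  functions, it is a norm on \<open>F\<close> iff it is definite there.  Dimension is expressed by a finite
  basis rather than by \<open>cfun.dim\<close>, which is 0 for infinite-dimensional spaces.\<close>

definition L2_function_space :: "'a measure \<Rightarrow> nat \<Rightarrow> ('a \<Rightarrow> complex) set \<Rightarrow> bool" where
  "L2_function_space M m F \<longleftrightarrow>
     cfun.subspace F \<and>
     (\<exists>B. finite B \<and> card B = m \<and> cfun.independent B \<and> cfun.span B = F) \<and>
     (\<forall>f\<in>F. \<forall>x. x \<notin> space M \<longrightarrow> f x = 0) \<and>
     (\<forall>f\<in>F. square_integrable M f) \<and>
     (\<forall>f\<in>F. norm_L2 M f = 0 \<longrightarrow> f = 0)"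

definition MZ_inequality ::
  "'a measure \<Rightarrow> ('a \<Rightarrow> complex) set \<Rightarrow> real \<Rightarrow> nat \<Rightarrow> (nat \<Rightarrow> 'a) \<Rightarrow> (nat \<Rightarrow> real) \<Rightarrow> bool" where
  "MZ_inequality M F \<epsilon> n x w \<longleftrightarrow>
     (\<forall>f\<in>F. (1 - \<epsilon>) * (norm_L2 M f)\<^sup>2 \<le> (\<Sum>i<n. w i * (cmod (f (x i)))\<^sup>2) \<and>
            (\<Sum>i<n. w i * (cmod (f (x i)))\<^sup>2) \<le> (1 + \<epsilon>) * (norm_L2 M f)\<^sup>2)"

definition MZ_positive :: "'a measure \<Rightarrow> ('a \<Rightarrow> complex) set \<Rightarrow> nat \<Rightarrow> real \<Rightarrow> bool" where
  "MZ_positive M F n \<epsilon> \<longleftrightarrow>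
     (\<exists>x w. (\<forall>i<n. x i \<in> space M) \<and> inj_on x {..<n} \<and> (\<forall>i<n. 0 < w i) \<and>
            MZ_inequality M F \<epsilon> n x w)"

text \<open>The least number of nodes; it is \<open>\<infinity>\<close> if no number of nodes works, and an attained
  minimum otherwise.\<close>

definition MZ_min_points :: "'a measure \<Rightarrow> ('a \<Rightarrow> complex) set \<Rightarrow> real \<Rightarrow> enat" where
  "MZ_min_points M F \<epsilon> = Inf {enat n | n. MZ_positive M F n \<epsilon>}"

text \<open>The supremum ranges over all measure spaces whose underlying set is a subset of a type
  \<open>'a\<close>.  HOL cannot quantify over all types inside a term, so the type is a parameter of the
  definition.  It should be infinite to have room for the extremal spaces; results about all
  measure spaces are stated for an arbitrary infinite type \<open>'a\<close>.\<close>

definition MZ_number :: "'a itself \<Rightarrow> nat \<Rightarrow> real \<Rightarrow> enat" where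
  "MZ_number _ m \<epsilon> =
     Sup {MZ_min_points M F \<epsilon> | (M :: 'a measure) F. L2_function_space M m F}"

end

theory Submission
  imports Defs
begin

text \<open>
  In an orthonormal basis of the function space, evaluation at a point \<open>x\<close> becomes a vector of
  \<open>\<complex>\<^sup>m\<close>, and a weighted Marcinkiewicz--Zygmund inequality says that a nonnegative combination of
  the rank-one forms of these vectors lies between \<open>1 - \<epsilon>\<close> and \<open>1 + \<epsilon>\<close> times the identity.

  Upper bounds. The integral of a vector-valued function lies in the convex cone generated by its
  values (\<open>integral_in_conic_hull\<close>, Tchakaloff's theorem).  Hermitian \<open>m \<times> m\<close> forms make up a real
  space of dimension \<open>m\<^sup>2\<close>, so by Caratheodory's theorem at most \<open>m\<^sup>2\<close> points give an exact
  quadrature for all products of two elements of the space.  This settles \<open>\<epsilon> = 0\<close> from above and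
  turns the weighted evaluations at these points into a finite Parseval frame of \<open>\<complex>\<^sup>m\<close>.  The
  barrier method of Batson, Spielman and Srivastava (\<open>frame_sparsification\<close>) selects \<open>n\<close> of the
  frame vectors, with new weights, such that the resulting form has upper to lower bound ratio
  \<open>((r + 1) / (r - 1))\<^sup>2\<close>, where \<open>r = sqrt (n / m)\<close>.  Since \<open>n \<ge> 4 m / \<epsilon>\<^sup>2\<close> is enough for
  distortion \<open>\<epsilon>\<close>, rounding up stays below \<open>5 m / \<epsilon>\<^sup>2\<close>.

  Lower bounds. For \<open>\<epsilon> = 0\<close> the extremal space lives on \<open>m\<^sup>2\<close> points whose rank-one forms are
  linearly independent, so that all weights are forced to be \<open>1\<close> (\<open>tomography_exact\<close>).  For
  \<open>\<epsilon> > 0\<close> the points are the edges of the complete graph on \<open>m + 1\<close> vertices and the functions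
  are the differences of vertex potentials.  An \<open>n\<close>-point inequality is then a weighted graph with
  \<open>n\<close> edges whose Laplacian approximates that of the complete graph.  The trace of its square is at
  least \<open>T\<^sup>2 (1 / (m + 1) + 1 / (2 n))\<close>, where \<open>T\<close> is its trace, whereas the spectral bound gives
  an upper estimate, and comparing the two yields the claim (\<open>complete_graph_sparsifier\<close>).
  The bound \<open>m\<close> holds because some nonzero function vanishes at fewer than \<open>m\<close> given points.
\<close>

section \<open>Exact quadrature by conic combinations\<close>

lemma exists_nontrivial_relation:
  fixes a :: "'t \<Rightarrow> 'k \<Rightarrow> 'f::field"
  assumes "finite K" "finite T" "card K < card T"
  shows "\<exists>c. (\<exists>x\<in>T. c x \<noteq> 0) \<and> (\<forall>k\<in>K. (\<Sum>x\<in>T. c x * a x k) = 0)"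
  using assms
proof (induction K arbitrary: T a rule: finite_induct)
  case empty
  then obtain x where "x \<in> T" by (metis card.empty card_gt_0_iff ex_in_conv)
  then show ?case by (intro exI[of _ "\<lambda>_. 1"]) auto
next
  case (insert j K)
  show ?case
  proof (cases "\<forall>x\<in>T. a x j = 0")
    case True
    have "card K < card T" using insert by simp
    with insert.IH[of T a] insert.prems obtain c where
      "\<exists>x\<in>T. c x \<noteq> 0" "\<forall>k\<in>K. (\<Sum>x\<in>T. c x * a x k) = 0" by blast
    with True show ?thesis by (intro exI[of _ c]) auto
  next
    case False
    then obtain p where p: "p \<in> T" "a p j \<noteq> 0" by blast
    define b where "b x k = a x k - a x j / a p j * a p k" for x k
    have "card K < card (T - {p})" using insert p by simp
    with insert.IH[of "T - {p}" b] insert.prems obtain c where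
      c: "\<exists>x\<in>T - {p}. c x \<noteq> 0" "\<And>k. k \<in> K \<Longrightarrow> (\<Sum>x\<in>T - {p}. c x * b x k) = 0" by blast
    define d where "d = c(p := - (\<Sum>x\<in>T - {p}. c x * a x j) / a p j)"
    have split: "(\<Sum>x\<in>T. d x * a x k)
        = d p * a p k + (\<Sum>x\<in>T - {p}. c x * a x k)" for k
      using insert.prems p by (subst sum.remove[of T p]) (auto simp: d_def intro!: sum.cong)
    have "(\<Sum>x\<in>T. d x * a x k) = 0" if "k \<in> K" for k
    proof -
      have "(\<Sum>x\<in>T - {p}. c x * b x k)
          = (\<Sum>x\<in>T - {p}. c x * a x k) + d p * a p k"
        unfolding b_def d_def
        by (simp add: algebra_simps sum_subtractf sum_distrib_left sum_divide_distrib)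
      with c(2)[OF that] split[of k] show ?thesis by (simp add: add.commute)
    qed
    moreover have "(\<Sum>x\<in>T. d x * a x j) = 0"
      using split[of j] p by (simp add: d_def)
    moreover have "\<exists>x\<in>T. d x \<noteq> 0" using c(1) by (auto simp: d_def)
    ultimately show ?thesis by (intro exI[of _ d]) auto
  qed
qed

lemma conic_caratheodory:
  fixes g :: "'t \<Rightarrow> 'k \<Rightarrow> real"
  assumes "finite K" "finite T" "\<And>x. x \<in> T \<Longrightarrow> 0 \<le> w x"
  shows "\<exists>T' w'. T' \<subseteq> T \<and> card T' \<le> card K \<and> (\<forall>x\<in>T'. 0 < w' x) \<and>
           (\<forall>k\<in>K. (\<Sum>x\<in>T'. w' x * g x k) = (\<Sum>x\<in>T. w x * g x k))"
  using assms(2,3)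
proof (induction "card T" arbitrary: T w rule: less_induct)
  case less
  note [simp] = \<open>finite T\<close>
  have drop: ?case if w': "\<And>x. x \<in> T \<Longrightarrow> 0 \<le> w' x" "y \<in> T" "w' y = 0"
      "\<And>k. k \<in> K \<Longrightarrow> (\<Sum>x\<in>T. w' x * g x k) = (\<Sum>x\<in>T. w x * g x k)" for w' y
  proof -
    have eq: "(\<Sum>x\<in>T - {y}. w' x * g x k) = (\<Sum>x\<in>T. w x * g x k)" if "k \<in> K" for k
      using w'(4)[OF that] w'(2,3) by (simp add: sum.remove[of T y])
    have "card (T - {y}) < card T" using w'(2) by (intro psubset_card_mono) auto
    from less.hyps[OF this, of w'] w'(1) obtain T2 w2 where
      "T2 \<subseteq> T - {y}" "card T2 \<le> card K" "\<forall>x\<in>T2. 0 < w2 x"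
      "\<forall>k\<in>K. (\<Sum>x\<in>T2. w2 x * g x k) = (\<Sum>x\<in>T - {y}. w' x * g x k)" by auto
    with eq show ?thesis by (intro exI[of _ T2] exI[of _ w2]) auto
  qed
  consider (zero) y where "y \<in> T" "w y = 0" | (small) "\<forall>x\<in>T. 0 < w x" "card T \<le> card K"
    | (big) "\<forall>x\<in>T. 0 < w x" "card K < card T"
    using less.prems(2) by (metis leI less_le)
  then show ?case
  proof cases
    case zero
    then show ?thesis using drop[of w y] less.prems by auto
  next
    case small
    then show ?thesis by (intro exI[of _ T] exI[of _ w]) auto
  next
    case big
    obtain c0 x0 where c0: "x0 \<in> T" "c0 x0 \<noteq> 0" "\<forall>k\<in>K. (\<Sum>x\<in>T. c0 x * g x k) = 0"
      using exists_nontrivial_relation[OF \<open>finite K\<close> \<open>finite T\<close> big(2), of g] by blast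
    define c where "c x = sgn (c0 x0) * c0 x" for x
    have c: "(\<Sum>x\<in>T. c x * g x k) = 0" if "k \<in> K" for k
      using c0(3) that by (simp add: c_def mult.assoc sum_distrib_left[symmetric])
    have cx0: "0 < c x0" using c0 by (auto simp: c_def sgn_if)
    \<comment> \<open>The largest multiple of the relation that can be subtracted while all weights stay
      nonnegative makes one of them vanish.\<close>
    define P where "P = {x \<in> T. 0 < c x}"
    define t where "t = Min ((\<lambda>x. w x / c x) ` P)"
    have P: "finite P" "P \<noteq> {}" using c0(1) cx0 by (auto simp: P_def)
    have "t \<in> (\<lambda>x. w x / c x) ` P" unfolding t_def using P by (intro Min_in) auto
    then obtain y where y: "y \<in> P" "t = w y / c y" by blast
    have tle: "t \<le> w x / c x" if "x \<in> P" for x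
      unfolding t_def using P that by simp
    have t0: "0 \<le> t" using y big(1) by (auto simp: P_def less_imp_le)
    show ?thesis
    proof (rule drop[of "\<lambda>x. w x - t * c x" y])
      show "0 \<le> w x - t * c x" if "x \<in> T" for x
      proof (cases "0 < c x")
        case True
        then show ?thesis using tle[of x] that by (simp add: P_def field_simps)
      next
        case False
        then have "t * c x \<le> 0" using t0 by (simp add: mult_nonneg_nonpos)
        then show ?thesis using less.prems(2)[OF that] by linarith
      qed
      show "y \<in> T" "w y - t * c y = 0" using y by (auto simp: P_def)
      show "(\<Sum>x\<in>T. (w x - t * c x) * g x k) = (\<Sum>x\<in>T. w x * g x k)" if "k \<in> K" for k
        using c[OF that]
        by (simp add: left_diff_distrib sum_subtractf mult.assoc sum_distrib_left[symmetric])
    qed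
  qed
qed

text \<open>Convex cones containing the origin.  The ambient space consists of all functions on the index
  type; where only coordinates in a finite set \<open>K\<close> matter, the statements restrict to \<open>K\<close>.\<close>

definition is_cone :: "('k \<Rightarrow> real) set \<Rightarrow> bool" where
  "is_cone C \<longleftrightarrow> (\<lambda>_. 0) \<in> C \<and> (\<forall>c\<in>C. \<forall>d\<in>C. (\<lambda>k. c k + d k) \<in> C) \<and>
     (\<forall>c\<in>C. \<forall>t\<ge>0. (\<lambda>k. t * c k) \<in> C)"

text \<open>A convex cone that does not fill the space has a nonzero nonnegative linear functional.  The
  cone need not be closed.  The proof adds one coordinate at a time and extends a functional from
  the hyperplane as in the theorem of M. Riesz.\<close>

lemma cone_nonneg_functional:
  assumes "finite K" "is_cone C" "\<not> (\<forall>p. \<exists>c\<in>C. \<forall>k\<in>K. c k = p k)"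
  shows "\<exists>l. (\<exists>k\<in>K. l k \<noteq> 0) \<and> (\<forall>c\<in>C. 0 \<le> (\<Sum>k\<in>K. l k * c k))"
  using assms
proof (induction K arbitrary: C rule: finite_induct)
  case empty
  then show ?case by (auto simp: is_cone_def)
next
  case (insert j K)
  have add: "(\<lambda>k. c k + d k) \<in> C" if "c \<in> C" "d \<in> C" for c d
    using insert.prems that by (simp add: is_cone_def)
  have scale: "(\<lambda>k. t * c k) \<in> C" if "c \<in> C" "0 \<le> t" for c t
    using insert.prems that by (simp add: is_cone_def)
  define C0 where "C0 = {c \<in> C. c j = 0}"
  have C0: "is_cone C0" using insert.prems by (auto simp: C0_def is_cone_def)
  have coord: "(\<Sum>k\<in>insert j K. (if k = j then s else 0) * c k) = s * c j" for s and c :: "'a \<Rightarrow> real"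
    using insert.hyps by (auto intro!: sum.neutral)
  consider (pos) "\<forall>c\<in>C. 0 \<le> c j" | (neg) "\<forall>c\<in>C. c j \<le> 0"
    | (both) "\<exists>c\<in>C. 0 < c j" "\<exists>c\<in>C. c j < 0" by force
  then show ?case
  proof cases
    case pos
    then show ?thesis by (intro exI[of _ "\<lambda>k. if k = j then 1 else 0"]) (unfold coord, auto)
  next
    case neg
    then show ?thesis by (intro exI[of _ "\<lambda>k. if k = j then -1 else 0"]) (unfold coord, auto)
  next
    case both
    then obtain cp cn where cp: "cp \<in> C" "0 < cp j" and cn: "cn \<in> C" "cn j < 0" by blast
    have "\<not> (\<forall>p. \<exists>c\<in>C0. \<forall>k\<in>K. c k = p k)"
    proof
      assume full: "\<forall>p. \<exists>c\<in>C0. \<forall>k\<in>K. c k = p k"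
      have "\<exists>c\<in>C. \<forall>k\<in>insert j K. c k = p k" for p
      proof -
        obtain d where d: "d \<in> C" "d j = p j"
        proof (cases "0 \<le> p j")
          case True
          then show ?thesis using scale[OF cp(1), of "p j / cp j"] cp
            by (intro that[of "\<lambda>k. p j / cp j * cp k"]) auto
        next
          case False
          then show ?thesis using scale[OF cn(1), of "p j / cn j"] cn
            by (intro that[of "\<lambda>k. p j / cn j * cn k"]) (auto simp: zero_le_divide_iff)
        qed
        obtain c where c: "c \<in> C0" "\<forall>k\<in>K. c k = p k - d k" using full by (rule allE[of _ "\<lambda>k. p k - d k"]) auto
        show ?thesis using c d add[of c d] by (intro bexI[of _ "\<lambda>k. c k + d k"]) (auto simp: C0_def)
      qed
      with insert.prems(2) show False by blast
    qed
    then obtain l where l: "\<exists>k\<in>K. l k \<noteq> 0" "\<And>c. c \<in> C0 \<Longrightarrow> 0 \<le> (\<Sum>k\<in>K. l k * c k)"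
      using insert.IH[OF C0] by blast
    \<comment> \<open>The functional on the hyperplane extends: the value at the new coordinate must separate
      the lower bounds from elements with positive coordinate from the upper bounds from
      elements with negative coordinate.\<close>
    define q where "q c = (\<Sum>k\<in>K. l k * c k)" for c
    have mix: "- q c / c j \<le> q d / (- d j)" if "c \<in> C" "0 < c j" "d \<in> C" "d j < 0" for c d
    proof -
      have "(\<lambda>k. (- d j) * c k + c j * d k) \<in> C0"
        using add[OF scale[of c "- d j"] scale[of d "c j"]] that by (simp add: C0_def)
      moreover have "(\<Sum>k\<in>K. l k * ((- d j) * c k + c j * d k)) = - d j * q c + c j * q d"
        unfolding q_def sum_distrib_left sum.distrib[symmetric] by (intro sum.cong) (auto simp: algebra_simps)
      ultimately have "0 \<le> - d j * q c + c j * q d" using l(2) by metis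
      then show ?thesis using that by (simp add: field_simps)
    qed
    define A where "A = (\<lambda>c. - q c / c j) ` {c \<in> C. 0 < c j}"
    have bdd: "bdd_above A" unfolding A_def
      using mix cn by (intro bdd_aboveI[of _ "q cn / (- cn j)"]) auto
    have up: "- q c / c j \<le> Sup A" if "c \<in> C" "0 < c j" for c
      using that bdd by (intro cSup_upper) (auto simp: A_def)
    have lo: "Sup A \<le> q d / (- d j)" if "d \<in> C" "d j < 0" for d
      using that mix cp by (intro cSup_least) (auto simp: A_def)
    define l' where "l' = l(j := Sup A)"
    have l': "(\<Sum>k\<in>insert j K. l' k * c k) = Sup A * c j + q c" for c
      using insert.hyps unfolding l'_def q_def by (auto intro!: sum.cong)
    have "0 \<le> Sup A * c j + q c" if "c \<in> C" for c
    proof -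
      consider "c j = 0" | "0 < c j" | "c j < 0" by linarith
      then show ?thesis
      proof cases
        case 1
        then show ?thesis using l(2)[of c] that by (simp add: C0_def q_def)
      next
        case 2
        then show ?thesis using up[of c] that by (simp add: field_simps)
      next
        case 3
        then show ?thesis using lo[of c] that by (simp add: field_simps)
      qed
    qed
    moreover have "\<exists>k\<in>insert j K. l' k \<noteq> 0"
      using l(1) insert.hyps by (auto simp: l'_def)
    ultimately show ?thesis by (intro exI[of _ l']) (auto simp: l')
  qed
qed

text \<open>The integral of a vector-valued function lies in the convex cone generated by the values on any
  set of full measure.  No closedness of the cone is needed.  If the values and the negative
  of the integral generate the whole space as a cone, then in particular they generate the integral,
  which can be solved for.  Otherwise some nonzero functional is nonnegative on the values and
  nonpositive at the integral.  It then vanishes at almost all values, which makes one coordinate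
  redundant.\<close>

lemma integral_in_conic_hull:
  fixes g :: "'a \<Rightarrow> 'k \<Rightarrow> real"
  assumes "finite K" "\<And>k. k \<in> K \<Longrightarrow> integrable M (\<lambda>x. g x k)" "AE x in M. x \<in> S"
  shows "\<exists>T w. finite T \<and> T \<subseteq> S \<and> (\<forall>x\<in>T. 0 \<le> w x) \<and>
           (\<forall>k\<in>K. (\<integral>x. g x k \<partial>M) = (\<Sum>x\<in>T. w x * g x k))"
  using assms
proof (induction "card K" arbitrary: K S rule: less_induct)
  case less
  note [simp] = \<open>finite K\<close> and int = less.prems(2)
  define p where "p k = (\<integral>x. g x k \<partial>M)" for k
  define comb where "comb T w t k = (\<Sum>x\<in>T. w x * g x k) - t * p k" for T and w :: "'a \<Rightarrow> real" and t k
  define C where "C = {comb T w t | T w t. finite T \<and> T \<subseteq> S \<and> (\<forall>x\<in>T. 0 \<le> w x) \<and> 0 \<le> t}"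
  have CI: "comb T w t \<in> C" if "finite T" "T \<subseteq> S" "\<forall>x\<in>T. 0 \<le> w x" "0 \<le> t" for T w t
    using that by (auto simp: C_def)
  have cone: "is_cone C"
    unfolding is_cone_def
  proof (intro conjI ballI allI impI)
    show "(\<lambda>_. 0) \<in> C" using CI[of "{}" "\<lambda>_. 0" 0] by (simp add: comb_def[abs_def])
  next
    fix c d assume "c \<in> C" "d \<in> C"
    then obtain T w t T' w' t' where
      c: "c = comb T w t" "finite T" "T \<subseteq> S" "\<forall>x\<in>T. 0 \<le> w x" "0 \<le> t" and
      d: "d = comb T' w' t'" "finite T'" "T' \<subseteq> S" "\<forall>x\<in>T'. 0 \<le> w' x" "0 \<le> t'"
      by (auto simp: C_def)
    define W where "W x = (if x \<in> T then w x else 0) + (if x \<in> T' then w' x else 0)" for x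
    have "(\<Sum>x\<in>T \<union> T'. (if x \<in> T then w x else 0) * g x k) = (\<Sum>x\<in>T. w x * g x k)" for k
      using c d by (intro sum.mono_neutral_cong_right) auto
    moreover have "(\<Sum>x\<in>T \<union> T'. (if x \<in> T' then w' x else 0) * g x k) = (\<Sum>x\<in>T'. w' x * g x k)" for k
      using c d by (intro sum.mono_neutral_cong_right) auto
    ultimately have "comb (T \<union> T') W (t + t') = (\<lambda>k. c k + d k)"
      unfolding c d comb_def W_def distrib_right sum.distrib by (simp add: fun_eq_iff)
    moreover have "comb (T \<union> T') W (t + t') \<in> C"
      using c d by (intro CI) (auto simp: W_def)
    ultimately show "(\<lambda>k. c k + d k) \<in> C" by simp
  next
    fix c and s :: real assume "c \<in> C" "0 \<le> s"
    then obtain T w t where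
      c: "c = comb T w t" "finite T" "T \<subseteq> S" "\<forall>x\<in>T. 0 \<le> w x" "0 \<le> t" by (auto simp: C_def)
    have "comb T (\<lambda>x. s * w x) (s * t) = (\<lambda>k. s * c k)"
      unfolding c comb_def by (simp add: fun_eq_iff algebra_simps sum_distrib_left)
    moreover have "comb T (\<lambda>x. s * w x) (s * t) \<in> C" using c \<open>0 \<le> s\<close> by (intro CI) auto
    ultimately show "(\<lambda>k. s * c k) \<in> C" by simp
  qed
  show ?case
  proof (cases "\<forall>p. \<exists>c\<in>C. \<forall>k\<in>K. c k = p k")
    case True
    then obtain c where "c \<in> C" "\<forall>k\<in>K. c k = p k" by blast
    then obtain T w t where
      c: "finite T" "T \<subseteq> S" "\<forall>x\<in>T. 0 \<le> w x" "0 \<le> t" "\<forall>k\<in>K. comb T w t k = p k"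
      by (auto simp: C_def)
    have "p k = (\<Sum>x\<in>T. w x / (1 + t) * g x k)" if "k \<in> K" for k
    proof -
      have "(\<Sum>x\<in>T. w x * g x k) = (1 + t) * p k" using c(5) that by (auto simp: comb_def algebra_simps)
      moreover have "(\<Sum>x\<in>T. w x / (1 + t) * g x k) = (\<Sum>x\<in>T. w x * g x k) / (1 + t)"
        by (simp add: sum_divide_distrib)
      ultimately show ?thesis using c(4) by simp
    qed
    then show ?thesis using c unfolding p_def
      by (intro exI[of _ T] exI[of _ "\<lambda>x. w x / (1 + t)"]) auto
  next
    case False
    then obtain l j where l: "j \<in> K" "l j \<noteq> 0" "\<And>c. c \<in> C \<Longrightarrow> 0 \<le> (\<Sum>k\<in>K. l k * c k)"
      using cone_nonneg_functional[OF \<open>finite K\<close> cone] by blast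
    define h where "h x = (\<Sum>k\<in>K. l k * g x k)" for x
    have h0: "0 \<le> h x" if "x \<in> S" for x
      using l(3)[OF CI[of "{x}" "\<lambda>_. 1" 0]] that by (simp add: h_def comb_def)
    have hint: "integrable M h" unfolding h_def using int by auto
    have hI: "(\<integral>x. h x \<partial>M) = (\<Sum>k\<in>K. l k * p k)" unfolding h_def p_def using int by simp
    have "(\<integral>x. h x \<partial>M) \<le> 0"
      using l(3)[OF CI[of "{}" "\<lambda>_. 1" 1]] by (simp add: hI comb_def sum_negf)
    moreover have h0': "AE x in M. 0 \<le> h x" using less.prems(3) h0 by auto
    ultimately have "(\<integral>x. h x \<partial>M) = 0" using integral_nonneg_AE[OF h0'] by simp
    then have "AE x in M. h x = 0"
      using integral_nonneg_eq_0_iff_AE[OF hint h0'] by simp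
    then have AE: "AE x in M. x \<in> {x \<in> S. h x = 0}" using less.prems(3) by auto
    \<comment> \<open>Almost all of the space lies on a hyperplane, on which one coordinate is redundant.\<close>
    have "card (K - {j}) < card K" using l(1) by (intro psubset_card_mono) auto
    have "\<exists>T w. finite T \<and> T \<subseteq> {x \<in> S. h x = 0} \<and> (\<forall>x\<in>T. 0 \<le> w x) \<and>
        (\<forall>k\<in>K - {j}. (\<integral>x. g x k \<partial>M) = (\<Sum>x\<in>T. w x * g x k))"
      by (rule less.hyps[OF \<open>card (K - {j}) < card K\<close> _ int AE]) auto
    then obtain T w where
      T: "finite T" "T \<subseteq> {x \<in> S. h x = 0}" "\<forall>x\<in>T. 0 \<le> w x"
         "\<forall>k\<in>K - {j}. p k = (\<Sum>x\<in>T. w x * g x k)" unfolding p_def by blast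
    have "l j * p j = - (\<Sum>k\<in>K - {j}. l k * p k)"
      using \<open>(\<integral>x. h x \<partial>M) = 0\<close> hI sum.remove[OF \<open>finite K\<close> l(1), of "\<lambda>k. l k * p k"] by simp
    also have "\<dots> = - (\<Sum>k\<in>K - {j}. \<Sum>x\<in>T. w x * (l k * g x k))"
      using T(4) by (simp add: sum_distrib_left algebra_simps)
    also have "\<dots> = (\<Sum>x\<in>T. w x * - (\<Sum>k\<in>K - {j}. l k * g x k))"
      by (subst sum.swap) (simp add: sum_distrib_left sum_negf)
    also have "\<dots> = (\<Sum>x\<in>T. w x * (l j * g x j))"
    proof (rule sum.cong)
      fix x assume "x \<in> T"
      then have "h x = 0" using T by auto
      then show "w x * - (\<Sum>k\<in>K - {j}. l k * g x k) = w x * (l j * g x j)"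
        unfolding h_def using sum.remove[OF \<open>finite K\<close> l(1), of "\<lambda>k. l k * g x k"]
        by (metis eq_neg_iff_add_eq_0)
    qed simp
    also have "\<dots> = l j * (\<Sum>x\<in>T. w x * g x j)"
      by (simp add: sum_distrib_left algebra_simps)
    finally have "p j = (\<Sum>x\<in>T. w x * g x j)" using l(2) by simp
    then have "\<forall>k\<in>K. p k = (\<Sum>x\<in>T. w x * g x k)" using T(4) by blast
    then show ?thesis using T(1-3) unfolding p_def by blast
  qed
qed

lemma exact_quadrature:
  fixes g :: "'a \<Rightarrow> 'k \<Rightarrow> real"
  assumes "finite K" "\<And>k. k \<in> K \<Longrightarrow> integrable M (\<lambda>x. g x k)"
  obtains T w where "finite T" "T \<subseteq> space M" "card T \<le> card K" "\<And>x. x \<in> T \<Longrightarrow> 0 < w x"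
    "\<And>k. k \<in> K \<Longrightarrow> (\<integral>x. g x k \<partial>M) = (\<Sum>x\<in>T. w x * g x k)"
proof -
  have "\<exists>T w. finite T \<and> T \<subseteq> space M \<and> (\<forall>x\<in>T. 0 \<le> w x) \<and>
      (\<forall>k\<in>K. (\<integral>x. g x k \<partial>M) = (\<Sum>x\<in>T. w x * g x k))"
    by (rule integral_in_conic_hull[OF assms AE_space])
  then obtain T w where T: "finite T" "T \<subseteq> space M" "\<And>x. x \<in> T \<Longrightarrow> 0 \<le> w x"
      "\<forall>k\<in>K. (\<integral>x. g x k \<partial>M) = (\<Sum>x\<in>T. w x * g x k)" by blast
  have "\<exists>T' w'. T' \<subseteq> T \<and> card T' \<le> card K \<and> (\<forall>x\<in>T'. 0 < w' x) \<and>
      (\<forall>k\<in>K. (\<Sum>x\<in>T'. w' x * g x k) = (\<Sum>x\<in>T. w x * g x k))"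
    by (rule conic_caratheodory[OF assms(1) T(1,3)])
  then obtain T' w' where T': "T' \<subseteq> T" "card T' \<le> card K" "\<forall>x\<in>T'. 0 < w' x"
      "\<forall>k\<in>K. (\<Sum>x\<in>T'. w' x * g x k) = (\<Sum>x\<in>T. w x * g x k)" by blast
  show ?thesis
  proof (rule that)
    show "finite T'" "T' \<subseteq> space M" "card T' \<le> card K" using T T' finite_subset by blast+
    show "0 < w' x" if "x \<in> T'" for x using T' that by blast
    show "(\<integral>x. g x k \<partial>M) = (\<Sum>x\<in>T'. w' x * g x k)" if "k \<in> K" for k
      using T(4) T'(4) that by simp
  qed
qed

section \<open>Sparsification of Parseval frames\<close>

text \<open>The standard inner product on \<open>\<complex>\<^sup>m\<close>, antilinear in the first argument.  Vectors are
  represented by arbitrary functions on the natural numbers, of which only the first \<open>m\<close>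
  values matter; hence \<open>cip m\<close> is a degenerate form on the representing functions, and
  equations between vectors are stated by testing against all vectors.\<close>

definition cip :: "nat \<Rightarrow> (nat \<Rightarrow> complex) \<Rightarrow> (nat \<Rightarrow> complex) \<Rightarrow> complex" where
  "cip m x y = (\<Sum>k<m. cnj (x k) * y k)"

text \<open>The squared Euclidean norm on \<open>\<complex>\<^sup>m\<close>.\<close>

definition sqnorm :: "nat \<Rightarrow> (nat \<Rightarrow> complex) \<Rightarrow> real" where
  "sqnorm m x = (\<Sum>k<m. (cmod (x k))\<^sup>2)"

text \<open>Hermitian sesquilinear forms, linear in the second argument.\<close>

definition hform :: "((nat \<Rightarrow> complex) \<Rightarrow> (nat \<Rightarrow> complex) \<Rightarrow> complex) \<Rightarrow> bool" where
  "hform b \<longleftrightarrow> (\<forall>x y z c. b x (\<lambda>k. y k + c * z k) = b x y + c * b x z) \<and>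
     (\<forall>x y. b y x = cnj (b x y))"

text \<open>Positive semidefinite Hermitian forms.\<close>

definition psd :: "((nat \<Rightarrow> complex) \<Rightarrow> (nat \<Rightarrow> complex) \<Rightarrow> complex) \<Rightarrow> bool" where
  "psd b \<longleftrightarrow> hform b \<and> (\<forall>x. 0 \<le> Re (b x x))"

text \<open>\<open>R\<close> is the inverse of the operator that represents the form \<open>b\<close> with respect to the inner
  product.  Linearity of \<open>R\<close> is not required: up to the degeneracy of the inner product it
  follows when \<open>b\<close> is Hermitian, since \<open>R\<close> is then self-adjoint.\<close>

definition inverts :: "nat \<Rightarrow> ((nat \<Rightarrow> complex) \<Rightarrow> (nat \<Rightarrow> complex) \<Rightarrow> complex) \<Rightarrow>
    ((nat \<Rightarrow> complex) \<Rightarrow> (nat \<Rightarrow> complex)) \<Rightarrow> bool" where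
  "inverts m b R \<longleftrightarrow> (\<forall>x z. b z (R x) = cip m z x)"

lemma hform_lin: "hform b \<Longrightarrow> b x (\<lambda>k. y k + c * z k) = b x y + c * b x z"
  and hform_cnj: "hform b \<Longrightarrow> b y x = cnj (b x y)"
  unfolding hform_def by blast+

lemma hform_lin_left:
  assumes "hform b"
  shows "b (\<lambda>k. y k + c * z k) x = b y x + cnj c * b z x"
proof -
  have e: "b w x = cnj (b x w)" for w by (rule hform_cnj[OF assms])
  show ?thesis unfolding e by (simp add: hform_lin[OF assms])
qed

lemma hform_self: "hform b \<Longrightarrow> b x x = of_real (Re (b x x))"
  using hform_cnj[of b x x] by (simp add: complex_eq_iff)

lemma psd_hform: "psd b \<Longrightarrow> hform b" and psd_nonneg: "psd b \<Longrightarrow> 0 \<le> Re (b x x)"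
  by (auto simp: psd_def)

lemma quadratic_cauchy_schwarz:
  fixes z :: complex and p q :: real
  assumes "0 \<le> p" "0 \<le> q" "\<And>c. 0 \<le> p + 2 * Re (c * z) + (cmod c)\<^sup>2 * q"
  shows "(cmod z)\<^sup>2 \<le> p * q"
proof -
  have t: "0 \<le> p - 2 * t * (cmod z)\<^sup>2 + t\<^sup>2 * (cmod z)\<^sup>2 * q" for t :: real
  proof -
    have "Re (of_real (-t) * cnj z * z) = - t * (cmod z)\<^sup>2"
      unfolding cmod_power2 by (simp add: power2_eq_square algebra_simps)
    with assms(3)[of "of_real (-t) * cnj z"] show ?thesis
      by (simp add: norm_mult power_mult_distrib)
  qed
  show ?thesis
  proof (cases "q = 0")
    case True
    have "z = 0"
    proof (rule ccontr)
      assume "z \<noteq> 0"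
      then have "2 * ((p + 1) / (2 * (cmod z)\<^sup>2)) * (cmod z)\<^sup>2 = p + 1" by simp
      then show False using t[of "(p + 1) / (2 * (cmod z)\<^sup>2)"] True by simp
    qed
    then show ?thesis using True by simp
  next
    case False
    with t[of "1 / q"] show ?thesis using assms(2)
      by (simp add: field_simps power2_eq_square)
  qed
qed

lemma psd_cauchy_schwarz:
  assumes "psd b"
  shows "(cmod (b x y))\<^sup>2 \<le> Re (b x x) * Re (b y y)"
proof (rule quadratic_cauchy_schwarz)
  note h = psd_hform[OF assms]
  fix c
  have "b (\<lambda>k. x k + c * y k) (\<lambda>k. x k + c * y k)
      = b x x + c * b x y + cnj (c * b x y) + cnj c * c * b y y"
    by (simp add: hform_lin[OF h] hform_lin_left[OF h] hform_cnj[OF h, of y x] algebra_simps)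
  then have "Re (b (\<lambda>k. x k + c * y k) (\<lambda>k. x k + c * y k))
      = Re (b x x) + 2 * Re (c * b x y) + (cmod c)\<^sup>2 * Re (b y y)"
    unfolding cmod_power2 by (subst (asm) hform_self[OF h, of y]) (simp add: power2_eq_square algebra_simps)
  then show "0 \<le> Re (b x x) + 2 * Re (c * b x y) + (cmod c)\<^sup>2 * Re (b y y)"
    using psd_nonneg[OF assms] by metis
qed (auto intro: psd_nonneg assms)

lemma psd_sum_cauchy_schwarz:
  assumes "psd b"
  shows "(\<Sum>i\<in>I. Re (b (x i) (y i)))\<^sup>2 \<le> (\<Sum>i\<in>I. Re (b (x i) (x i))) * (\<Sum>i\<in>I. Re (b (y i) (y i)))"
proof -
  define p where "p i = sqrt (Re (b (x i) (x i)))" for i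
  define q where "q i = sqrt (Re (b (y i) (y i)))" for i
  have "\<bar>Re (b (x i) (y i))\<bar> \<le> p i * q i" for i
  proof -
    have "\<bar>Re (b (x i) (y i))\<bar> \<le> cmod (b (x i) (y i))" by (rule abs_Re_le_cmod)
    also have "\<dots> \<le> p i * q i"
      unfolding p_def q_def real_sqrt_mult[symmetric]
      by (rule real_le_rsqrt) (rule psd_cauchy_schwarz[OF assms])
    finally show ?thesis .
  qed
  then have "\<bar>\<Sum>i\<in>I. Re (b (x i) (y i))\<bar> \<le> (\<Sum>i\<in>I. p i * q i)"
    by (intro order_trans[OF sum_abs] sum_mono)
  then have "(\<Sum>i\<in>I. Re (b (x i) (y i)))\<^sup>2 \<le> (\<Sum>i\<in>I. p i * q i)\<^sup>2"
    by (metis abs_ge_zero power2_abs power_mono)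
  also have "\<dots> \<le> (\<Sum>i\<in>I. (p i)\<^sup>2) * (\<Sum>i\<in>I. (q i)\<^sup>2)" by (rule Cauchy_Schwarz_ineq_sum)
  finally show ?thesis by (simp add: p_def q_def psd_nonneg[OF assms])
qed

lemma cip_hform: "hform (cip m)"
  by (auto simp: hform_def cip_def sum.distrib sum_distrib_left algebra_simps)

lemmas cip_lin = hform_lin[OF cip_hform]
  and cip_cnj = hform_cnj[OF cip_hform]

lemma cip_sum: "cip m x (\<lambda>k. \<Sum>i\<in>I. c i * v i k) = (\<Sum>i\<in>I. c i * cip m x (v i))"
  unfolding cip_def by (simp add: sum_distrib_left mult.left_commute) (rule sum.swap)

lemma cip_scale: "cip m x (\<lambda>k. c * y k) = c * cip m x y"
  unfolding cip_def by (simp add: sum_distrib_left mult.left_commute)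

lemma cip_self: "cip m x x = of_real (sqnorm m x)"
  unfolding cip_def sqnorm_def of_real_sum complex_norm_square by (simp add: mult.commute)

lemma sqnorm_nonneg: "0 \<le> sqnorm m x" by (simp add: sqnorm_def sum_nonneg)

lemma cip_psd: "psd (cip m)" by (simp add: psd_def cip_hform cip_self sqnorm_nonneg)

lemma cip_null: "sqnorm m w = 0 \<Longrightarrow> cip m z w = 0" "sqnorm m w = 0 \<Longrightarrow> cip m w z = 0"
  using psd_cauchy_schwarz[OF cip_psd, of m z w] psd_cauchy_schwarz[OF cip_psd, of m w z]
  by (simp_all add: cip_self)

lemma cip_mult_cnj: "cip m x y * cip m y x = of_real ((cmod (cip m x y))\<^sup>2)"
  by (subst cip_cnj[of m y x]) (simp only: complex_norm_square)

lemma inverts_adjoint: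
  assumes "hform b" "inverts m b R"
  shows "cip m x (R y) = b (R x) (R y)" "cip m (R x) y = cip m x (R y)"
  using assms cip_cnj[of m x "R y"] hform_cnj[OF assms(1), of "R x" "R y"]
  by (auto simp: inverts_def)

lemma inverts_psd:
  assumes "psd b" "inverts m b R"
  shows "psd (\<lambda>x y. cip m x (R y))"
proof -
  note adj = inverts_adjoint[OF psd_hform[OF assms(1)] assms(2)]
  show ?thesis unfolding psd_def
  proof (intro conjI allI)
    show "0 \<le> Re (cip m x (R x))" for x using psd_nonneg[OF assms(1)] by (simp add: adj(1))
    show "hform (\<lambda>x y. cip m x (R y))"
      unfolding hform_def
    proof (intro conjI allI)
      show "cip m x (R (\<lambda>k. y k + c * z k)) = cip m x (R y) + c * cip m x (R z)" for x y z c
        unfolding adj(2)[symmetric] by (rule cip_lin)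
      show "cip m y (R x) = cnj (cip m x (R y))" for x y
        unfolding adj(2)[of x y, symmetric] by (rule cip_cnj)
    qed
  qed
qed

text \<open>The resolvent identity for two forms that differ by a multiple of the inner product, in both
  orders of the inverses.\<close>

lemma resolvent_identity:
  assumes "hform b" "hform b'" "inverts m b R" "inverts m b' R'"
    and "\<And>x y. b' x y = b x y + of_real d * cip m x y"
  shows "cip m x (R y) - cip m x (R' y) = of_real d * cip m (R' x) (R y)"
    "cip m x (R y) - cip m x (R' y) = of_real d * cip m (R x) (R' y)"
proof -
  have "cip m x (R y) = b' (R' x) (R y)"
    using assms(3,4) hform_cnj[OF assms(2), of "R y" "R' x"] cip_cnj[of m x "R y"]
      by (metis complex_cnj_cnj inverts_def)
  moreover have "b (R' x) (R y) = cip m x (R' y)"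
    using assms(3) inverts_adjoint[OF assms(2,4)] by (simp add: inverts_def)
  ultimately show "cip m x (R y) - cip m x (R' y) = of_real d * cip m (R' x) (R y)"
    by (simp add: assms(5))
  have "cip m x (R' y) = b (R x) (R' y)"
    using assms(3,4) hform_cnj[OF assms(1), of "R' y" "R x"] cip_cnj[of m x "R' y"]
      by (metis complex_cnj_cnj inverts_def)
  moreover have "b' (R x) (R' y) = cip m x (R y)"
    using assms(4) inverts_adjoint[OF assms(1,3)] by (simp add: inverts_def)
  ultimately show "cip m x (R y) - cip m x (R' y) = of_real d * cip m (R x) (R' y)"
    unfolding assms(5) by (metis add_diff_cancel_left')
qed

text \<open>A finite Parseval frame \<open>v\<close> of \<open>\<complex>\<^sup>m\<close>: the rank-one forms of the frame vectors sum to
  the inner product.\<close>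

locale parseval_frame =
  fixes m :: nat and I :: "'i set" and v :: "'i \<Rightarrow> nat \<Rightarrow> complex"
  assumes finite_I: "finite I"
    and parseval: "\<And>x y. cip m x y = (\<Sum>i\<in>I. cip m x (v i) * cip m (v i) y)"
begin

abbreviation "ip \<equiv> cip m"
abbreviation "nrm \<equiv> sqnorm m"

text \<open>The weighted frame operator shifted by a multiple of the identity, as a form.  All forms that
  occur in the barrier argument are of this shape.\<close>

definition form :: "real \<Rightarrow> ('i \<Rightarrow> real) \<Rightarrow> (nat \<Rightarrow> complex) \<Rightarrow> (nat \<Rightarrow> complex) \<Rightarrow> complex" where
  "form a s x y = of_real a * ip x y + (\<Sum>i\<in>I. of_real (s i) * (ip x (v i) * ip (v i) y))"

text \<open>For a self-adjoint operator this is the trace, because the frame is Parseval.\<close>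

definition tr :: "((nat \<Rightarrow> complex) \<Rightarrow> (nat \<Rightarrow> complex)) \<Rightarrow> real" where
  "tr R = (\<Sum>i\<in>I. Re (ip (v i) (R (v i))))"

text \<open>The squared Hilbert--Schmidt norm, likewise computed through the frame.\<close>

definition hs :: "((nat \<Rightarrow> complex) \<Rightarrow> (nat \<Rightarrow> complex)) \<Rightarrow> real" where
  "hs R = (\<Sum>i\<in>I. nrm (R (v i)))"

lemma form_hform: "hform (form a s)"
  unfolding hform_def form_def
proof (intro conjI allI)
  fix x y z :: "nat \<Rightarrow> complex" and c :: complex
  show "of_real a * ip x (\<lambda>k. y k + c * z k) + (\<Sum>i\<in>I. of_real (s i) * (ip x (v i) * ip (v i) (\<lambda>k. y k + c * z k)))
     = of_real a * ip x y + (\<Sum>i\<in>I. of_real (s i) * (ip x (v i) * ip (v i) y)) +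
       c * (of_real a * ip x z + (\<Sum>i\<in>I. of_real (s i) * (ip x (v i) * ip (v i) z)))"
    by (simp add: cip_lin distrib_left sum.distrib sum_distrib_left) (simp add: mult_ac)
  have "cnj (ip x y) = ip y x" "\<And>i. cnj (ip x (v i)) = ip (v i) x" "\<And>i. cnj (ip (v i) y) = ip y (v i)"
    using cip_cnj by metis+
  then show "of_real a * ip y x + (\<Sum>i\<in>I. of_real (s i) * (ip y (v i) * ip (v i) x))
     = cnj (of_real a * ip x y + (\<Sum>i\<in>I. of_real (s i) * (ip x (v i) * ip (v i) y)))"
    by (simp add: mult_ac)
qed

lemma form_self: "Re (form a s x x) = a * nrm x + (\<Sum>i\<in>I. s i * (cmod (ip (v i) x))\<^sup>2)"
proof -
  have "ip x (v i) * ip (v i) x = of_real ((cmod (ip (v i) x))\<^sup>2)" for i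
    using cip_mult_cnj[of m "v i" x] by (simp add: mult.commute)
  then show ?thesis by (simp add: form_def cip_self flip: of_real_mult)
qed

lemma form_update:
  assumes "j \<in> I"
  shows "form a (s(j := s j + t)) x y = form a s x y + of_real t * (ip x (v j) * ip (v j) y)"
  unfolding form_def
  by (simp add: sum.remove[OF finite_I assms] algebra_simps)

lemma form_shift: "form (a + d) s x y = form a s x y + of_real d * ip x y"
  by (simp add: form_def algebra_simps)

lemma sum_sqnorm_frame: "(\<Sum>i\<in>I. nrm (v i)) = real m"
proof -
  have "(\<Sum>i\<in>I. (cmod (v i k))\<^sup>2) = 1" if "k < m" for k
  proof -
    define e :: "nat \<Rightarrow> complex" where "e j = (if j = k then 1 else 0)" for j
    have e: "ip e x = x k" "ip x e = cnj (x k)" for x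
    proof -
      have "ip e x = (\<Sum>j<m. if j = k then x j else 0)"
        unfolding cip_def e_def by (intro sum.cong) auto
      then show "ip e x = x k" using that by simp
      have "ip x e = (\<Sum>j<m. if j = k then cnj (x j) else 0)"
        unfolding cip_def e_def by (intro sum.cong) auto
      then show "ip x e = cnj (x k)" using that by simp
    qed
    have "of_real (\<Sum>i\<in>I. (cmod (v i k))\<^sup>2) = ip e e"
      unfolding parseval[of e e] of_real_sum complex_norm_square by (simp add: e mult.commute)
    also have "\<dots> = 1" unfolding e by (simp add: e_def)
    finally show ?thesis by (metis of_real_eq_1_iff)
  qed
  then show ?thesis unfolding sqnorm_def by (subst sum.swap) simp
qed

lemma form_nondegenerate:
  assumes "inverts m (form a s) R" "nrm (R x) = 0"
  shows "nrm x = 0"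
proof -
  have "ip x x = form a s x (R x)" using assms(1) by (simp add: inverts_def)
  also have "\<dots> = 0" unfolding form_def using cip_null[OF assms(2)] by simp
  finally show ?thesis by (simp add: cip_self)
qed

text \<open>The images of the \<open>m\<close> unit vectors under the operator of the form, together with the right-hand
  side \<open>x\<close>, satisfy a nontrivial linear relation.  The coefficient of \<open>x\<close> in it cannot vanish by
  definiteness, so the relation solves the linear system.\<close>

lemma form_inverse_exists:
  assumes "0 < c" "\<And>x. c * nrm x \<le> Re (form a s x x)"
  shows "\<exists>R. inverts m (form a s) R"
proof -
  define B where "B y k = of_real a * y k + (\<Sum>i\<in>I. of_real (s i) * ip (v i) y * v i k)" for y k
  have form_B: "form a s z y = ip z (B y)" for z y
  proof -
    have "ip z (\<lambda>k. (\<Sum>i\<in>I. of_real (s i) * ip (v i) y * v i k) + of_real a * y k)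
        = (\<Sum>i\<in>I. of_real (s i) * ip (v i) y * ip z (v i)) + of_real a * ip z y"
      by (simp add: cip_lin cip_sum)
    then show ?thesis by (simp add: form_def B_def[abs_def] add.commute mult_ac)
  qed
  have "\<exists>y. \<forall>z. form a s z y = ip z x" for x
  proof -
    define e :: "nat \<Rightarrow> nat \<Rightarrow> complex" where "e t j = (if j = t then 1 else 0)" for t j
    obtain b where b: "\<exists>t\<in>{..m}. b t \<noteq> 0"
      "\<And>k. k < m \<Longrightarrow> (\<Sum>t\<le>m. b t * (if t = m then x k else B (e t) k)) = 0"
      using exists_nontrivial_relation[of "{..<m}" "{..m}" "\<lambda>t k. if t = m then x k else B (e t) k"]
      by auto
    define y where "y j = (\<Sum>t<m. b t * e t j)" for j
    have yj: "y j = b j" if "j < m" for j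
    proof -
      have "y j = (\<Sum>t<m. if t = j then b t else 0)" unfolding y_def e_def by (intro sum.cong) auto
      then show ?thesis using that by simp
    qed
    have By: "B y k = (\<Sum>t<m. b t * B (e t) k)" for k
    proof -
      have "ip (v i) y = (\<Sum>t<m. b t * ip (v i) (e t))" for i
        unfolding y_def[abs_def] by (rule cip_sum)
      then have "B y k = of_real a * (\<Sum>t<m. b t * e t k) + (\<Sum>i\<in>I. \<Sum>t<m. b t * (of_real (s i) * ip (v i) (e t) * v i k))"
        unfolding B_def by (simp add: y_def sum_distrib_left sum_distrib_right mult_ac)
      also have "(\<Sum>i\<in>I. \<Sum>t<m. b t * (of_real (s i) * ip (v i) (e t) * v i k))
          = (\<Sum>t<m. \<Sum>i\<in>I. b t * (of_real (s i) * ip (v i) (e t) * v i k))" by (rule sum.swap)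
      finally show ?thesis
        unfolding B_def by (simp add: distrib_left sum.distrib sum_distrib_left mult_ac)
    qed
    have rel: "B y k = - b m * x k" if "k < m" for k
    proof -
      have "(\<Sum>t\<le>m. b t * (if t = m then x k else B (e t) k)) = (\<Sum>t<m. b t * B (e t) k) + b m * x k"
        by (simp add: lessThan_Suc_atMost[symmetric])
      then show ?thesis using b(2)[OF that] By by (simp add: eq_neg_iff_add_eq_0)
    qed
    have fy: "form a s z y = - b m * ip z x" for z
    proof -
      have "ip z (B y) = ip z (\<lambda>k. - b m * x k)" unfolding cip_def using rel by (intro sum.cong) auto
      then show ?thesis unfolding form_B by (simp only: cip_scale)
    qed
    have "b m \<noteq> 0"
    proof
      assume "b m = 0"
      then have "c * nrm y \<le> 0" using assms(2)[of y] fy by simp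
      then have "nrm y = 0" using assms(1) sqnorm_nonneg[of m y] by (simp add: mult_le_0_iff)
      then have "\<forall>k<m. b k = 0" using yj by (auto simp: sqnorm_def sum_nonneg_eq_0_iff)
      with \<open>b m = 0\<close> b(1) show False by (metis atMost_iff le_neq_implies_less)
    qed
    then have "form a s z (\<lambda>k. 0 + (- 1 / b m) * y k) = form a s z (\<lambda>_. 0) + ip z x" for z
      by (subst hform_lin[OF form_hform]) (simp add: fy)
    moreover have "form a s z (\<lambda>_. 0) = 0" for z by (simp add: form_def cip_def)
    ultimately show ?thesis by (intro exI[of _ "\<lambda>k. 0 + (- 1 / b m) * y k"]) simp
  qed
  then show ?thesis unfolding inverts_def by metis
qed

text \<open>The inverse after a rank-one update, and its trace.\<close>

lemma sherman_morrison:
  assumes "hform b" "inverts m b R" "1 + t * Re (ip w (R w)) \<noteq> 0"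
  shows "\<exists>R'. inverts m (\<lambda>x y. b x y + of_real t * (ip x w * ip w y)) R' \<and>
    tr R' = tr R - t / (1 + t * Re (ip w (R w))) * nrm (R w)"
proof -
  define \<kappa> where "\<kappa> = t / (1 + t * Re (ip w (R w)))"
  define R' where "R' = (\<lambda>y k. R y k + (- of_real \<kappa> * ip (R w) y) * R w k)"
  note adj = inverts_adjoint[OF assms(1,2)]
  define q where "q = Re (ip w (R w))"
  have q: "ip w (R w) = of_real q"
    unfolding q_def using adj(2)[of w w] cip_cnj[of m w "R w"] by (simp add: complex_eq_iff)
  have k: "\<kappa> = t - t * \<kappa> * q" using assms(3) unfolding \<kappa>_def q_def[symmetric]
    by (simp add: field_simps)
  have "inverts m (\<lambda>x y. b x y + of_real t * (ip x w * ip w y)) R'"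
    unfolding inverts_def
  proof (intro allI)
    fix y z
    define \<alpha> where "\<alpha> = ip w (R y)"
    have 1: "b z (R' y) = ip z y - of_real \<kappa> * \<alpha> * ip z w"
      using assms(2) unfolding R'_def hform_lin[OF assms(1)] by (simp add: adj(2) \<alpha>_def inverts_def)
    have 2: "ip w (R' y) = \<alpha> - of_real \<kappa> * \<alpha> * of_real q"
      unfolding R'_def cip_lin by (simp add: q adj(2) \<alpha>_def)
    have "b z (R' y) + of_real t * (ip z w * ip w (R' y))
        = ip z y + ip z w * \<alpha> * of_real (t - t * \<kappa> * q - \<kappa>)"
      unfolding 1 2 by (simp add: algebra_simps)
    with k show "b z (R' y) + of_real t * (ip z w * ip w (R' y)) = ip z y" by simp
  qed
  moreover have "Re (ip (v i) (R' (v i))) = Re (ip (v i) (R (v i))) - \<kappa> * Re (ip (R w) (v i) * ip (v i) (R w))" for i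
    unfolding R'_def cip_lin by (simp add: algebra_simps)
  then have "tr R' = tr R - \<kappa> * Re (\<Sum>i\<in>I. ip (R w) (v i) * ip (v i) (R w))"
    unfolding tr_def Re_sum by (simp only: sum_subtractf sum_distrib_left)
  then have "tr R' = tr R - \<kappa> * nrm (R w)"
    by (simp add: parseval[symmetric] cip_self)
  ultimately show ?thesis unfolding \<kappa>_def by blast
qed

text \<open>A positive semidefinite form with an inverse is bounded below by the reciprocal of the trace
  of its inverse.  Hence a bound for the trace leaves room for shifting the lower barrier.\<close>

lemma inverts_trace_psd:
  assumes "psd (form a s)" "inverts m (form a s) R"
  shows "nrm y \<le> Re (form a s y y) * tr R"
proof -
  have "(cmod (ip y (v i)))\<^sup>2 \<le> Re (form a s y y) * Re (ip (v i) (R (v i)))" for i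
  proof -
    have "ip y (v i) = form a s y (R (v i))" using assms(2) by (simp add: inverts_def)
    then show ?thesis
      using psd_cauchy_schwarz[OF assms(1), of y "R (v i)"]
      by (simp add: inverts_adjoint(1)[OF psd_hform[OF assms(1)] assms(2)])
  qed
  then have "(\<Sum>i\<in>I. (cmod (ip y (v i)))\<^sup>2) \<le> Re (form a s y y) * tr R"
    unfolding tr_def sum_distrib_left by (rule sum_mono)
  moreover have "of_real (nrm y) = complex_of_real (\<Sum>i\<in>I. (cmod (ip y (v i)))\<^sup>2)"
    unfolding cip_self[symmetric] parseval[of y y] by (simp add: cip_mult_cnj)
  then have "nrm y = (\<Sum>i\<in>I. (cmod (ip y (v i)))\<^sup>2)" by (simp only: of_real_eq_iff)
  ultimately show ?thesis by simp
qed

lemma hs_pos: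
  assumes "inverts m (form a s) R" "0 < m"
  shows "0 < hs R"
proof (rule ccontr)
  assume "\<not> 0 < hs R"
  then have "hs R = 0" unfolding hs_def by (simp add: sum_nonneg sqnorm_nonneg antisym not_less)
  then have "\<forall>i\<in>I. nrm (v i) = 0"
    using form_nondegenerate[OF assms(1)] finite_I
    by (auto simp: hs_def sum_nonneg_eq_0_iff sqnorm_nonneg)
  then show False using sum_sqnorm_frame assms(2) by simp
qed

text \<open>Shifting a positive form by \<open>d\<close> decreases the trace of the inverse by at least \<open>d\<close> times the
  squared Hilbert--Schmidt norm of the inverse of the shifted form.\<close>

lemma trace_shift:
  assumes "psd (form a s)" "psd (form (a + d) s)" "0 \<le> d"
    and "inverts m (form a s) R" "inverts m (form (a + d) s) R'"
  shows "d * hs R' \<le> tr R - tr R'"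
proof -
  note h = psd_hform[OF assms(1)] and h' = psd_hform[OF assms(2)]
  note res = resolvent_identity[OF h h' assms(4,5) form_shift]
  have "d * nrm (R' x) \<le> Re (ip x (R x)) - Re (ip x (R' x))" for x
  proof -
    have "ip x (R x) - ip x (R' x) = of_real d * ip (R' x) (R x)" by (rule res(1))
    moreover have "ip (R' x) (R x) = ip (R' x) (R' x) + of_real d * ip (R' x) (R (R' x))"
    proof -
      have "ip (R' x) (R x) - ip (R' x) (R' x) = of_real d * ip (R (R' x)) (R' x)" by (rule res(2))
      then show ?thesis
        using inverts_adjoint(2)[OF h assms(4), of "R' x" "R' x"] by (simp add: diff_eq_eq add.commute)
    qed
    ultimately have "Re (ip x (R x)) - Re (ip x (R' x)) = d * nrm (R' x) + d\<^sup>2 * Re (ip (R' x) (R (R' x)))"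
      by (simp add: complex_eq_iff cip_self power2_eq_square algebra_simps)
    moreover have "0 \<le> Re (ip (R' x) (R (R' x)))"
      using psd_nonneg[OF inverts_psd[OF assms(1,4)]] by blast
    ultimately show ?thesis by simp
  qed
  then have "(\<Sum>i\<in>I. d * nrm (R' (v i))) \<le> (\<Sum>i\<in>I. Re (ip (v i) (R (v i))) - Re (ip (v i) (R' (v i))))"
    by (rule sum_mono)
  then show ?thesis by (simp add: hs_def tr_def sum_subtractf sum_distrib_left)
qed

text \<open>The estimate in the opposite direction, with a quadratic gain in the difference of the traces.
  The gain comes from the Cauchy--Schwarz inequality and pays for the lower barrier.\<close>

lemma trace_shift_lower:
  assumes "psd (form a s)" "psd (form (a + d) s)" "0 \<le> d"
    and "inverts m (form a s) R" "inverts m (form (a + d) s) R'" "d * tr R' \<le> 1"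
  shows "(tr R - tr R') + d * (tr R - tr R')\<^sup>2 \<le> d * hs R"
proof -
  note h = psd_hform[OF assms(1)] and h' = psd_hform[OF assms(2)]
  note res = resolvent_identity[OF h h' assms(4,5) form_shift]
  note psd' = inverts_psd[OF assms(2,5)]
  define X where "X = (\<Sum>i\<in>I. Re (ip (v i) (R' (R (v i)))))"
  define Y where "Y = (\<Sum>i\<in>I. Re (ip (R (v i)) (R' (R (v i)))))"
  have "Re (ip x (R x)) - Re (ip x (R' x)) = d * Re (ip x (R' (R x)))" for x
  proof -
    have "ip x (R x) - ip x (R' x) = of_real d * ip x (R' (R x))"
      unfolding res(1) by (simp add: inverts_adjoint(2)[OF h' assms(5)])
    then show ?thesis by (simp add: complex_eq_iff)
  qed
  then have diff: "tr R - tr R' = d * X"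
    by (simp add: tr_def X_def sum_subtractf[symmetric] sum_distrib_left)
  have "nrm (R x) = Re (ip x (R' (R x))) + d * Re (ip (R x) (R' (R x)))" for x
  proof -
    have "ip (R x) (R x) - ip (R x) (R' x) = of_real d * ip (R' (R x)) (R x)" by (rule res(1))
    moreover have "Re (ip (R' (R x)) (R x)) = Re (ip (R x) (R' (R x)))"
      by (simp add: inverts_adjoint(2)[OF h' assms(5)])
    moreover have "Re (ip (R x) (R' x)) = Re (ip x (R' (R x)))"
      using cip_cnj[of m "R x" "R' x"] inverts_adjoint(2)[OF h' assms(5), of x "R x"] by simp
    ultimately show ?thesis by (simp add: complex_eq_iff cip_self)
  qed
  then have hs: "hs R = X + d * Y"
    by (simp add: hs_def X_def Y_def sum.distrib sum_distrib_left)
  have "Y \<ge> 0" unfolding Y_def by (intro sum_nonneg psd_nonneg[OF psd'])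
  have "X\<^sup>2 \<le> tr R' * Y" unfolding X_def Y_def tr_def by (rule psd_sum_cauchy_schwarz[OF psd'])
  then have "d * (d * X\<^sup>2) \<le> d * ((d * tr R') * Y)"
    using assms(3) by (simp add: mult_left_mono mult.assoc)
  also have "\<dots> \<le> d * (1 * Y)"
    by (intro mult_left_mono mult_right_mono assms \<open>Y \<ge> 0\<close>)
  finally have "d * (d * X\<^sup>2) \<le> d * Y" by simp
  then have "d * (d * (d * X\<^sup>2)) \<le> d * (d * Y)" using assms(3) by (rule mult_left_mono)
  then show ?thesis unfolding diff hs by (simp add: power2_eq_square algebra_simps)
qed

text \<open>The upper barrier \<open>u\<close> with potential at most \<open>e\<close>: the frame operator with weights \<open>s\<close> is
  at most \<open>u\<close>, and the inverse of \<open>u\<close> minus that operator has trace at most \<open>e\<close>.\<close>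

definition upper_barrier :: "real \<Rightarrow> ('i \<Rightarrow> real) \<Rightarrow> real \<Rightarrow> bool" where
  "upper_barrier u s e \<longleftrightarrow> psd (form u (\<lambda>i. - s i)) \<and> (\<exists>R. inverts m (form u (\<lambda>i. - s i)) R \<and> tr R \<le> e)"

text \<open>The lower barrier \<open>l\<close> with potential at most \<open>e\<close>: the frame operator with weights \<open>s\<close> is
  at least \<open>l\<close>, and the inverse of that operator minus \<open>l\<close> has trace at most \<open>e\<close>.\<close>

definition lower_barrier :: "real \<Rightarrow> ('i \<Rightarrow> real) \<Rightarrow> real \<Rightarrow> bool" where
  "lower_barrier l s e \<longleftrightarrow> psd (form (- l) s) \<and> (\<exists>R. inverts m (form (- l) s) R \<and> tr R \<le> e)"

lemma psd_form_shift:
  assumes "0 \<le> c" "\<And>x. c * nrm x \<le> Re (form a s x x)"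
  shows "psd (form a s)"
  unfolding psd_def
proof (intro conjI allI)
  show "0 \<le> Re (form a s x x)" for x
    by (rule order_trans[OF _ assms(2)]) (simp add: assms(1) sqnorm_nonneg)
qed (rule form_hform)

lemma upper_barrier_shift:
  assumes "upper_barrier u s e" "0 < d" "0 < m"
  obtains R \<Delta> where "psd (form (u + d) (\<lambda>i. - s i))" "inverts m (form (u + d) (\<lambda>i. - s i)) R"
    "0 < \<Delta>" "hs R / \<Delta> \<le> 1 / d" "tr R + \<Delta> \<le> e"
proof -
  let ?s = "\<lambda>i. - s i"
  obtain R where R: "psd (form u ?s)" "inverts m (form u ?s) R" "tr R \<le> e"
    using assms(1) unfolding upper_barrier_def by blast
  have low: "d * nrm x \<le> Re (form (u + d) ?s x x)" for x
    using psd_nonneg[OF R(1), of x] by (simp add: form_shift cip_self)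
  obtain R' where R': "inverts m (form (u + d) ?s) R'"
    using form_inverse_exists[OF assms(2) low] by blast
  have psd: "psd (form (u + d) ?s)" using psd_form_shift[OF _ low] assms(2) by simp
  have le: "d * hs R' \<le> tr R - tr R'" using trace_shift[OF R(1) psd _ R(2) R'] assms(2) by simp
  have "0 < d * hs R'" using hs_pos[OF R' assms(3)] assms(2) by simp
  then have "0 < tr R - tr R'" using le by linarith
  moreover have "hs R' / (tr R - tr R') \<le> 1 / d"
    using le assms(2) \<open>0 < tr R - tr R'\<close> by (simp add: field_simps)
  ultimately show ?thesis using that[OF psd R', of "tr R - tr R'"] R(3) by simp
qed

lemma lower_barrier_shift:
  assumes "lower_barrier l s e" "0 < d" "0 < m" "0 < e" "d * e < 1"
  obtains R \<Delta> where "psd (form (- (l + d)) s)" "inverts m (form (- (l + d)) s) R"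
    "0 < \<Delta>" "1 / d + \<Delta> \<le> hs R / \<Delta>" "tr R - \<Delta> \<le> e"
proof -
  obtain R where R: "psd (form (- l) s)" "inverts m (form (- l) s) R" "tr R \<le> e"
    using assms(1) unfolding lower_barrier_def by blast
  have shift: "- (l + d) + d = - l" by simp
  have low: "(1 / e - d) * nrm x \<le> Re (form (- (l + d)) s x x)" for x
  proof -
    have "nrm x \<le> Re (form (- l) s x x) * e"
      using inverts_trace_psd[OF R(1,2), of x] mult_left_mono[OF R(3) psd_nonneg[OF R(1)], of x] by linarith
    then have "nrm x / e \<le> Re (form (- l) s x x)" using assms(4) by (simp add: field_simps)
    moreover have "Re (form (- l) s x x) = Re (form (- (l + d)) s x x) + d * nrm x"
      using form_shift[of "- (l + d)" d s x x] by (simp add: cip_self)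
    ultimately show ?thesis by (simp add: left_diff_distrib)
  qed
  have c: "0 < 1 / e - d" using assms(4,5) by (simp add: field_simps)
  obtain R' where R': "inverts m (form (- (l + d)) s) R'"
    using form_inverse_exists[OF c low] by blast
  have psd: "psd (form (- (l + d)) s)" using psd_form_shift[OF _ low] c by simp
  have dtr: "d * tr R \<le> 1" using mult_left_mono[OF R(3), of d] assms(2,5) by linarith
  define \<Delta> where "\<Delta> = tr R' - tr R"
  have R2: "psd (form (- (l + d) + d) s)" "inverts m (form (- (l + d) + d) s) R"
    using R unfolding shift by simp_all
  have "d * hs R \<le> \<Delta>" unfolding \<Delta>_def
    using trace_shift[OF psd R2(1) _ R' R2(2)] assms(2) by simp
  moreover have "0 < d * hs R" using hs_pos[OF R(2) assms(3)] assms(2) by simp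
  ultimately have pos: "0 < \<Delta>" by linarith
  have "\<Delta> + d * \<Delta>\<^sup>2 \<le> d * hs R'" unfolding \<Delta>_def
    using trace_shift_lower[OF psd R2(1) _ R' R2(2) dtr] assms(2) by simp
  then have "1 / d + \<Delta> \<le> hs R' / \<Delta>" using pos assms(2)
    by (simp add: field_simps power2_eq_square)
  then show ?thesis using that[OF psd R' pos] R(3) unfolding \<Delta>_def by simp
qed

text \<open>After the upper barrier has moved, the weight of \<open>v j\<close> can grow by \<open>t\<close> without exceeding
  the old potential, provided that \<open>1 / t\<close> is large enough; \<open>\<Delta>\<close> is the gain of the move.
  The next lemma is the counterpart for the lower barrier, where \<open>1 / t\<close> has to be small.\<close>

lemma upper_barrier_update:
  assumes "psd (form u (\<lambda>i. - s i))" "inverts m (form u (\<lambda>i. - s i)) R" "j \<in> I" "0 < t"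
    and "0 < \<Delta>" "0 < nrm (R (v j))" "nrm (R (v j)) / \<Delta> + Re (ip (v j) (R (v j))) \<le> 1 / t" "tr R + \<Delta> \<le> e"
  shows "upper_barrier u (s(j := s j + t)) e"
proof -
  define q where "q = Re (ip (v j) (R (v j)))"
  note adj = inverts_adjoint[OF form_hform assms(2)]
  have "0 < nrm (R (v j)) / \<Delta>" using assms by simp
  then have q1: "nrm (R (v j)) / \<Delta> \<le> 1 / t - q" "0 < 1 / t - q" using assms(7) by (auto simp: q_def)
  then have tq: "t * q < 1" using assms(4) by (simp add: field_simps)
  have upd: "form u (\<lambda>i. - (s(j := s j + t)) i)
      = (\<lambda>x y. form u (\<lambda>i. - s i) x y + of_real (- t) * (ip x (v j) * ip (v j) y))"
  proof -
    have "(\<lambda>i. - (s(j := s j + t)) i) = (\<lambda>i. - s i)(j := - s j + - t)" by auto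
    then show ?thesis using form_update[OF assms(3), of u "\<lambda>i. - s i" "- t"] by (intro ext) metis
  qed
  have psd: "psd (form u (\<lambda>i. - (s(j := s j + t)) i))"
    unfolding psd_def
  proof (intro conjI allI)
    fix x
    have "(cmod (ip x (v j)))\<^sup>2 \<le> Re (form u (\<lambda>i. - s i) x x) * q"
    proof -
      have "ip x (v j) = form u (\<lambda>i. - s i) x (R (v j))" using assms(2) by (simp add: inverts_def)
      then show ?thesis
        using psd_cauchy_schwarz[OF assms(1), of x "R (v j)"] by (simp add: adj(1) q_def)
    qed
    then have "t * (cmod (ip x (v j)))\<^sup>2 \<le> Re (form u (\<lambda>i. - s i) x x) * (t * q)"
      using assms(4) by (simp add: mult.left_commute)
    also have "\<dots> \<le> Re (form u (\<lambda>i. - s i) x x)"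
      using mult_left_mono[OF less_imp_le[OF tq] psd_nonneg[OF assms(1)], of x] by simp
    finally show "0 \<le> Re (form u (\<lambda>i. - (s(j := s j + t)) i) x x)"
      unfolding upd cip_mult_cnj by (simp flip: of_real_mult)
  qed (rule form_hform)
  have nz: "1 + - t * Re (ip (v j) (R (v j))) \<noteq> 0" using tq by (simp add: q_def)
  have "t / (1 - t * q) * nrm (R (v j)) = nrm (R (v j)) / (1 / t - q)"
    using assms(4) tq by (simp add: field_simps)
  also have "\<dots> \<le> \<Delta>" using q1 assms(5) by (simp add: field_simps)
  finally have "tr R - (- t) / (1 + - t * Re (ip (v j) (R (v j)))) * nrm (R (v j)) \<le> e"
    using assms(8) by (simp add: q_def)
  with sherman_morrison[OF form_hform assms(2) nz] obtain R' where "inverts m (form u (\<lambda>i. - (s(j := s j + t)) i)) R'" "tr R' \<le> e"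
    unfolding upd by auto
  then show ?thesis using psd unfolding upper_barrier_def by blast
qed

lemma lower_barrier_update:
  assumes "psd (form (- l) s)" "inverts m (form (- l) s) R" "j \<in> I" "0 < t"
    and "0 < \<Delta>" "1 / t \<le> nrm (R (v j)) / \<Delta> - Re (ip (v j) (R (v j)))" "tr R - \<Delta> \<le> e"
  shows "lower_barrier l (s(j := s j + t)) e"
proof -
  define q where "q = Re (ip (v j) (R (v j)))"
  have q0: "0 \<le> q" unfolding q_def by (rule psd_nonneg[OF inverts_psd[OF assms(1,2)]])
  have pos: "0 < 1 + t * q" using q0 assms(4) by (simp add: add_pos_nonneg)
  have upd: "form (- l) (s(j := s j + t))
      = (\<lambda>x y. form (- l) s x y + of_real t * (ip x (v j) * ip (v j) y))"
    by (intro ext) (rule form_update[OF assms(3)])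
  have psd: "psd (form (- l) (s(j := s j + t)))"
    unfolding psd_def
  proof (intro conjI allI)
    show "0 \<le> Re (form (- l) (s(j := s j + t)) x x)" for x
      unfolding upd cip_mult_cnj using psd_nonneg[OF assms(1), of x] assms(4)
      by (simp flip: of_real_mult)
  qed (rule form_hform)
  have nz: "1 + t * Re (ip (v j) (R (v j))) \<noteq> 0" using pos by (simp add: q_def)
  have "\<Delta> * (1 / t + q) \<le> nrm (R (v j))" using assms(5,6) by (simp add: q_def field_simps)
  then have "\<Delta> \<le> t / (1 + t * q) * nrm (R (v j))"
    using assms(4) pos by (simp add: field_simps)
  then have "tr R - t / (1 + t * Re (ip (v j) (R (v j)))) * nrm (R (v j)) \<le> e"
    using assms(7) by (simp add: q_def)
  with sherman_morrison[OF form_hform assms(2) nz] obtain R' where "inverts m (form (- l) (s(j := s j + t))) R'" "tr R' \<le> e"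
    unfolding upd by auto
  then show ?thesis using psd unfolding lower_barrier_def by blast
qed

text \<open>Both barriers advance and one frame vector gets more weight, without an increase of the
  potentials.  Summed over the frame, the constraint \<open>U\<close> of the upper barrier is at most the
  constraint \<open>L\<close> of the lower barrier, so some frame vector admits a weight that respects both.\<close>

lemma barrier_step:
  assumes "upper_barrier u s e" "lower_barrier l s e'" "0 < d" "0 < d'" "0 < e'" "d' * e' < 1" "0 < m"
    and "1 / d + e \<le> 1 / d' - e'"
  shows "\<exists>j\<in>I. \<exists>t>0. upper_barrier (u + d) (s(j := s j + t)) e \<and> lower_barrier (l + d') (s(j := s j + t)) e'"
proof -
  obtain R \<Delta> where R: "psd (form (u + d) (\<lambda>i. - s i))" "inverts m (form (u + d) (\<lambda>i. - s i)) R"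
    "0 < \<Delta>" "hs R / \<Delta> \<le> 1 / d" "tr R + \<Delta> \<le> e"
    using upper_barrier_shift[OF assms(1,3,7)] by blast
  obtain R' \<Delta>' where R': "psd (form (- (l + d')) s)" "inverts m (form (- (l + d')) s) R'"
    "0 < \<Delta>'" "1 / d' + \<Delta>' \<le> hs R' / \<Delta>'" "tr R' - \<Delta>' \<le> e'"
    using lower_barrier_shift[OF assms(2,4,7,5,6)] by blast
  define U where "U i = nrm (R (v i)) / \<Delta> + Re (ip (v i) (R (v i)))" for i
  define L where "L i = nrm (R' (v i)) / \<Delta>' - Re (ip (v i) (R' (v i)))" for i
  have "(\<Sum>i\<in>I. U i) = hs R / \<Delta> + tr R"
    by (simp add: U_def hs_def tr_def sum.distrib sum_divide_distrib)
  moreover have "(\<Sum>i\<in>I. L i) = hs R' / \<Delta>' - tr R'"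
    by (simp add: L_def hs_def tr_def sum_subtractf sum_divide_distrib)
  ultimately have sums: "(\<Sum>i\<in>I. U i) \<le> (\<Sum>i\<in>I. L i)"
    using R R' assms(8) by linarith
  have zero: "U i = 0" "L i = 0" if "nrm (v i) = 0" for i
  proof -
    have "nrm (Q (v i)) = 0" if "inverts m (form a w) Q" for Q a w
    proof -
      have "ip (Q (v i)) (Q (v i)) = ip (Q (Q (v i))) (v i)"
        by (rule inverts_adjoint(2)[OF form_hform that, symmetric])
      also have "\<dots> = 0" by (rule cip_null(1)[OF \<open>nrm (v i) = 0\<close>])
      finally show ?thesis by (simp add: cip_self)
    qed
    from this[OF R(2)] this[OF R'(2)] show "U i = 0" "L i = 0"
      using cip_null(2)[OF that] by (simp_all add: U_def L_def)
  qed
  have "\<exists>j\<in>I. 0 < nrm (v j) \<and> U j \<le> L j"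
  proof (rule ccontr)
    assume no: "\<not> ?thesis"
    then have less: "L i < U i" if "i \<in> I" "0 < nrm (v i)" for i using that by force
    have "\<exists>i\<in>I. 0 < nrm (v i)"
    proof (rule ccontr)
      assume "\<not> ?thesis"
      then have "\<forall>i\<in>I. nrm (v i) = 0" using sqnorm_nonneg by (metis less_le)
      then show False using sum_sqnorm_frame assms(7) by simp
    qed
    moreover have "L i \<le> U i" if "i \<in> I" for i
    proof (cases "nrm (v i) = 0")
      case True
      then show ?thesis using zero[OF True] by simp
    next
      case False
      then show ?thesis using less[OF that] sqnorm_nonneg[of m "v i"] by simp
    qed
    ultimately have "(\<Sum>i\<in>I. L i) < (\<Sum>i\<in>I. U i)"
      using less by (intro sum_strict_mono_ex1[OF finite_I]) blast+
    with sums show False by simp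
  qed
  then obtain j where j: "j \<in> I" "0 < nrm (v j)" "U j \<le> L j" by blast
  have Rj: "0 < nrm (R (v j))"
    using form_nondegenerate[OF R(2), of "v j"] j(2) sqnorm_nonneg[of m "R (v j)"] by fastforce
  moreover have "0 \<le> Re (ip (v j) (R (v j)))" by (rule psd_nonneg[OF inverts_psd[OF R(1,2)]])
  ultimately have Uj: "0 < U j" unfolding U_def using R(3) by (simp add: add_pos_nonneg)
  have "upper_barrier (u + d) (s(j := s j + 1 / U j)) e"
    by (rule upper_barrier_update[OF R(1,2) j(1) _ R(3) Rj _ R(5)]) (use Uj in \<open>auto simp: U_def\<close>)
  moreover have "lower_barrier (l + d') (s(j := s j + 1 / U j)) e'"
    by (rule lower_barrier_update[OF R'(1,2) j(1) _ R'(3) _ R'(5)]) (use Uj j(3) in \<open>auto simp: L_def\<close>)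
  ultimately show ?thesis using j(1) Uj by (intro bexI[of _ j] exI[of _ "1 / U j"]) auto
qed

lemma scalar_inverse:
  assumes "0 < a"
  shows "psd (form a (\<lambda>_. 0))" "\<exists>R. inverts m (form a (\<lambda>_. 0)) R \<and> tr R \<le> real m / a"
proof -
  show "psd (form a (\<lambda>_. 0))"
    unfolding psd_def using assms by (simp add: form_hform form_self sqnorm_nonneg)
  define R :: "(nat \<Rightarrow> complex) \<Rightarrow> nat \<Rightarrow> complex" where "R x k = of_real (1 / a) * x k" for x k
  have R: "ip x (R y) = of_real (1 / a) * ip x y" for x y unfolding R_def[abs_def] by (rule cip_scale)
  have "inverts m (form a (\<lambda>_. 0)) R" unfolding inverts_def using assms by (simp add: form_def R)
  moreover have "tr R = real m / a"
    unfolding tr_def R cip_self sum_sqnorm_frame[symmetric] by (simp add: sum_divide_distrib)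
  ultimately show "\<exists>R. inverts m (form a (\<lambda>_. 0)) R \<and> tr R \<le> real m / a" by auto
qed

lemma barrier_iteration:
  assumes "0 < u" "l < 0" "0 < d" "0 < d'" "d' * (real m / - l) < 1" "0 < m"
    and "1 / d + real m / u \<le> 1 / d' - real m / - l"
  shows "\<exists>s. (\<forall>i. 0 \<le> s i) \<and> card {i \<in> I. 0 < s i} \<le> n \<and>
    upper_barrier (u + real n * d) s (real m / u) \<and> lower_barrier (l + real n * d') s (real m / - l)"
proof (induction n)
  case 0
  have "upper_barrier u (\<lambda>_. 0) (real m / u)" unfolding upper_barrier_def using scalar_inverse[OF assms(1)] by simp
  moreover have "lower_barrier l (\<lambda>_. 0) (real m / - l)" unfolding lower_barrier_def using scalar_inverse[of "- l"] assms(2) by simp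
  ultimately show ?case by (intro exI[of _ "\<lambda>_. 0"]) auto
next
  case (Suc n)
  then obtain s where s: "\<forall>i. 0 \<le> s i" "card {i \<in> I. 0 < s i} \<le> n"
    "upper_barrier (u + real n * d) s (real m / u)" "lower_barrier (l + real n * d') s (real m / - l)" by blast
  have "0 < real m / - l" using assms by (simp add: divide_pos_neg)
  then obtain j t where j: "j \<in> I" "0 < t" "upper_barrier (u + real n * d + d) (s(j := s j + t)) (real m / u)"
      "lower_barrier (l + real n * d' + d') (s(j := s j + t)) (real m / - l)"
    using barrier_step[OF s(3,4) assms(3,4) _ assms(5,6,7)] by blast
  have "{i \<in> I. 0 < (s(j := s j + t)) i} \<subseteq> insert j {i \<in> I. 0 < s i}" by auto
  then have "card {i \<in> I. 0 < (s(j := s j + t)) i} \<le> card (insert j {i \<in> I. 0 < s i})"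
    using finite_I by (intro card_mono) auto
  also have "\<dots> \<le> Suc n" using s(2) by (intro order_trans[OF card_insert_le_m1]) auto
  finally have "card {i \<in> I. 0 < (s(j := s j + t)) i} \<le> Suc n" .
  moreover have "\<forall>i. 0 \<le> (s(j := s j + t)) i" using s(1) j(2) by (simp add: add_nonneg_nonneg)
  moreover have "u + real (Suc n) * d = u + real n * d + d" "l + real (Suc n) * d' = l + real n * d' + d'"
    by (simp_all add: algebra_simps)
  ultimately show ?case using j(3,4) by metis
qed

lemma upper_barrier_bound: "upper_barrier u s e \<Longrightarrow> (\<Sum>i\<in>I. s i * (cmod (ip (v i) x))\<^sup>2) \<le> u * nrm x"
  unfolding upper_barrier_def psd_def by (auto simp: form_self sum_negf dest!: spec[of _ x])

lemma lower_barrier_bound: "lower_barrier l s e \<Longrightarrow> l * nrm x \<le> (\<Sum>i\<in>I. s i * (cmod (ip (v i) x))\<^sup>2)"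
  unfolding lower_barrier_def psd_def by (auto simp: form_self dest!: spec[of _ x])

text \<open>Starting from zero weights, \<open>n\<close> steps leave at most \<open>n\<close> vectors with positive weight, and the
  final barriers have ratio \<open>((r + 1) / (r - 1))\<^sup>2\<close> with \<open>r = sqrt (n / m)\<close>.  Rescaling puts the
  lower barrier at \<open>1 - \<epsilon>\<close>.\<close>

theorem frame_sparsification:
  assumes "0 < m" "0 < \<epsilon>" "\<epsilon> < 1" "4 * real m / \<epsilon>\<^sup>2 \<le> real n"
  shows "\<exists>s. (\<forall>i. 0 \<le> s i) \<and> card {i \<in> I. 0 < s i} \<le> n \<and>
    (\<forall>x. (1 - \<epsilon>) * nrm x \<le> (\<Sum>i\<in>I. s i * (cmod (ip (v i) x))\<^sup>2) \<and>
         (\<Sum>i\<in>I. s i * (cmod (ip (v i) x))\<^sup>2) \<le> (1 + \<epsilon>) * nrm x)"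
proof -
  define r where "r = sqrt (real n / real m)"
  have mn: "real n = real m * r\<^sup>2" using assms(1) by (simp add: r_def)
  have "(2 / \<epsilon>)\<^sup>2 \<le> real n / real m"
    using assms by (simp add: field_simps power2_eq_square)
  then have r2: "2 / \<epsilon> \<le> r" unfolding r_def by (rule real_le_rsqrt)
  have "2 < 2 / \<epsilon>" using assms by (simp add: field_simps)
  then have r: "2 < r" using r2 by simp
  have \<epsilon>r: "2 \<le> \<epsilon> * r" using r2 assms(2) by (simp add: field_simps)
  \<comment> \<open>Step widths \<open>d\<close> and \<open>1\<close> and starting barriers \<open>u\<close> and \<open>l\<close>, for which the balance of
    the two constraints holds with equality.\<close>
  define d where "d = (r + 1) / (r - 1)"
  define u where "u = real m * (r * (r + 1) / (r - 1))"
  define l where "l = - (real m * r)"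
  have m0: "0 < real m" using assms(1) by simp
  have eu: "real m / u = (r - 1) / (r * (r + 1))" unfolding u_def using m0 by simp
  have el: "real m / - l = 1 / r" unfolding l_def using m0 r by (simp add: field_simps)
  have "1 / d + real m / u = 1 / 1 - real m / - l"
    unfolding eu el d_def using r by (simp add: divide_simps) (simp add: algebra_simps)
  then obtain s where s: "\<forall>i. 0 \<le> s i" "card {i \<in> I. 0 < s i} \<le> n"
    "upper_barrier (u + real n * d) s (real m / u)" "lower_barrier (l + real n * 1) s (real m / - l)"
    using barrier_iteration[of u l d 1 n] r m0 el assms(1)
    by (auto simp: u_def l_def d_def)
  define c where "c = real m * (r * (r - 1))"
  have c0: "0 < c" unfolding c_def using m0 r by simp
  have lc: "l + real n * 1 = c" unfolding l_def c_def mn by (simp add: algebra_simps power2_eq_square)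
  have uc: "u + real n * d = c * ((r + 1)\<^sup>2 / (r - 1)\<^sup>2)"
    unfolding u_def d_def c_def mn using r by (simp add: divide_simps) (simp add: algebra_simps power2_eq_square)
  have "(1 - \<epsilon>) * (r + 1)\<^sup>2 \<le> (1 + \<epsilon>) * (r - 1)\<^sup>2"
  proof -
    have "2 * r \<le> \<epsilon> * r * r" using \<epsilon>r r by simp
    then have "2 * r \<le> \<epsilon> * (r\<^sup>2 + 1)" using assms(2) by (simp add: power2_eq_square algebra_simps)
    then show ?thesis by (simp add: power2_eq_square algebra_simps)
  qed
  then have ratio: "(1 - \<epsilon>) * ((r + 1)\<^sup>2 / (r - 1)\<^sup>2) \<le> 1 + \<epsilon>" using r by (simp add: field_simps)
  define f where "f = (1 - \<epsilon>) / c"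
  have f0: "0 < f" using c0 assms by (simp add: f_def)
  show ?thesis
  proof (intro exI[of _ "\<lambda>i. f * s i"] conjI allI)
    show "0 \<le> f * s i" for i using f0 s by simp
    show "card {i \<in> I. 0 < f * s i} \<le> n" using f0 s(2) by (simp add: zero_less_mult_iff)
    fix x
    define S where "S = (\<Sum>i\<in>I. s i * (cmod (ip (v i) x))\<^sup>2)"
    have S: "(\<Sum>i\<in>I. f * s i * (cmod (ip (v i) x))\<^sup>2) = f * S"
      by (simp add: S_def sum_distrib_left mult.assoc)
    have "f * (c * nrm x) \<le> f * S" unfolding S_def
      using lower_barrier_bound[OF s(4), of x] f0 by (simp only: lc mult_left_mono less_imp_le)
    then show "(1 - \<epsilon>) * nrm x \<le> (\<Sum>i\<in>I. f * s i * (cmod (ip (v i) x))\<^sup>2)"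
      unfolding S using c0 by (simp add: f_def)
    have "f * S \<le> f * (c * ((r + 1)\<^sup>2 / (r - 1)\<^sup>2) * nrm x)" unfolding S_def
      using upper_barrier_bound[OF s(3), of x] f0 by (simp only: uc mult_left_mono less_imp_le)
    also have "\<dots> = (1 - \<epsilon>) * ((r + 1)\<^sup>2 / (r - 1)\<^sup>2) * nrm x" using c0 by (simp add: f_def)
    also have "\<dots> \<le> (1 + \<epsilon>) * nrm x" by (intro mult_right_mono ratio sqnorm_nonneg)
    finally show "(\<Sum>i\<in>I. f * s i * (cmod (ip (v i) x))\<^sup>2) \<le> (1 + \<epsilon>) * nrm x" unfolding S .
  qed
qed

end

section \<open>Marcinkiewicz--Zygmund inequalities with few points\<close>

lemma sum_cfun_scale: "(\<Sum>k\<in>A. cfun_scale (c k) (b k)) = (\<lambda>x. \<Sum>k\<in>A. c k * b k x)"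
  by (induction A rule: infinite_finite_induct) (auto simp: cfun_scale_def fun_eq_iff)

lemma cfun_span_sum: "(\<And>k. k \<in> A \<Longrightarrow> b k \<in> cfun.span B) \<Longrightarrow> (\<lambda>x. \<Sum>k\<in>A. c k * b k x) \<in> cfun.span B"
  unfolding sum_cfun_scale[symmetric] by (intro cfun.span_sum cfun.span_scale)

lemma square_integrable_prod:
  assumes "square_integrable M f" "square_integrable M g"
  shows "integrable M (\<lambda>x. cnj (f x) * g x)"
proof (rule Bochner_Integration.integrable_bound)
  show "integrable M (\<lambda>x. (cmod (f x))\<^sup>2 + (cmod (g x))\<^sup>2)"
    using assms by (auto simp: square_integrable_def)
  have [measurable]: "f \<in> borel_measurable M" "g \<in> borel_measurable M"
    using assms by (auto simp: square_integrable_def)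
  have "cnj \<in> borel_measurable borel"
    by (intro borel_measurable_continuous_onI continuous_intros)
  then have [measurable]: "(\<lambda>x. cnj (f x)) \<in> borel_measurable M"
    using measurable_compose by fastforce
  show "(\<lambda>x. cnj (f x) * g x) \<in> borel_measurable M" by measurable
  have "a * b \<le> a\<^sup>2 + b\<^sup>2" if "0 \<le> a" "0 \<le> b" for a b :: real
    using sum_squares_bound[of a b] that mult_nonneg_nonneg[of a b] by linarith
  then show "AE x in M. cmod (cnj (f x) * g x) \<le> norm ((cmod (f x))\<^sup>2 + (cmod (g x))\<^sup>2)"
    by (simp add: norm_mult)
qed

lemma norm_L2_sq: "complex_of_real ((norm_L2 M f)\<^sup>2) = (\<integral>x. cnj (f x) * f x \<partial>M)"
proof -
  have "(norm_L2 M f)\<^sup>2 = (\<integral>x. (cmod (f x))\<^sup>2 \<partial>M)" by (simp add: norm_L2_def)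
  moreover have "(\<integral>x. cnj (f x) * f x \<partial>M) = (\<integral>x. complex_of_real ((cmod (f x))\<^sup>2) \<partial>M)"
    by (simp only: complex_norm_square mult.commute)
  ultimately show ?thesis by (simp only: integral_complex_of_real)
qed

text \<open>An orthonormal system of \<open>n\<close> square-integrable functions with respect to the inner product
  \<open>\<integral> cnj f * g\<close>.\<close>

definition orthonormal_family :: "'a measure \<Rightarrow> nat \<Rightarrow> (nat \<Rightarrow> 'a \<Rightarrow> complex) \<Rightarrow> bool" where
  "orthonormal_family M n b \<longleftrightarrow> (\<forall>k<n. square_integrable M (b k)) \<and>
     (\<forall>j<n. \<forall>k<n. (\<integral>x. cnj (b j x) * b k x \<partial>M) = (if j = k then 1 else 0))"

lemma orthonormal_family_inner_sum:
  assumes "orthonormal_family M n b" "j < n"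
  shows "(\<integral>x. cnj (b j x) * (\<Sum>k<n. c k * b k x) \<partial>M) = c j"
proof -
  have int: "integrable M (\<lambda>x. cnj (b j x) * b k x)" if "k < n" for k
    using assms that by (intro square_integrable_prod) (auto simp: orthonormal_family_def)
  have "(\<integral>x. cnj (b j x) * (\<Sum>k<n. c k * b k x) \<partial>M) = (\<integral>x. (\<Sum>k<n. c k * (cnj (b j x) * b k x)) \<partial>M)"
    by (simp add: sum_distrib_left mult.left_commute)
  also have "\<dots> = (\<Sum>k<n. c k * (\<integral>x. cnj (b j x) * b k x \<partial>M))"
    using int by (subst Bochner_Integration.integral_sum) auto
  also have "\<dots> = (\<Sum>k<n. if k = j then c k else 0)"
    using assms by (intro sum.cong) (auto simp: orthonormal_family_def)
  finally show ?thesis using assms(2) by simp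
qed

lemma orthonormal_family_norm:
  assumes "orthonormal_family M n b" "square_integrable M f" "f = (\<lambda>x. \<Sum>k<n. c k * b k x)"
  shows "(norm_L2 M f)\<^sup>2 = sqnorm n c"
proof -
  have int: "integrable M (\<lambda>x. cnj (b k x) * f x)" if "k < n" for k
    using assms that by (intro square_integrable_prod) (auto simp: orthonormal_family_def)
  have "(\<integral>x. cnj (f x) * f x \<partial>M) = (\<integral>x. (\<Sum>k<n. cnj (c k) * (cnj (b k x) * f x)) \<partial>M)"
    by (subst (1) assms(3)) (simp add: sum_distrib_right mult.assoc)
  also have "\<dots> = (\<Sum>k<n. cnj (c k) * (\<integral>x. cnj (b k x) * f x \<partial>M))"
    using int by (subst Bochner_Integration.integral_sum) auto
  also have "\<dots> = (\<Sum>k<n. cnj (c k) * c k)"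
    unfolding assms(3) using orthonormal_family_inner_sum[OF assms(1)] by simp
  also have "\<dots> = of_real (sqnorm n c)" unfolding cip_self[symmetric] cip_def ..
  finally show ?thesis unfolding norm_L2_sq[symmetric] by (simp only: of_real_eq_iff)
qed

lemma gram_schmidt_L2:
  assumes "finite B" "cfun.independent B"
    and "\<And>f. f \<in> cfun.span B \<Longrightarrow> square_integrable M f"
    and "\<And>f. f \<in> cfun.span B \<Longrightarrow> norm_L2 M f = 0 \<Longrightarrow> f = 0"
  shows "\<exists>b. orthonormal_family M (card B) b \<and> (\<forall>k<card B. b k \<in> cfun.span B) \<and>
    (\<forall>f\<in>cfun.span B. \<exists>c. f = (\<lambda>x. \<Sum>k<card B. c k * b k x))"
  using assms
proof (induction B rule: finite_induct)
  case empty
  then show ?case by (auto simp: orthonormal_family_def fun_eq_iff)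
next
  case (insert a B)
  define n where "n = card B"
  have sub: "cfun.span B \<subseteq> cfun.span (insert a B)" by (intro cfun.span_mono) auto
  have "cfun.independent B" using insert.prems(1) cfun.independent_mono by blast
  then obtain b where b: "orthonormal_family M n b" "\<And>k. k < n \<Longrightarrow> b k \<in> cfun.span B"
      "\<And>f. f \<in> cfun.span B \<Longrightarrow> \<exists>c. f = (\<lambda>x. \<Sum>k<n. c k * b k x)"
    using insert.IH insert.prems(2,3) sub unfolding n_def by blast
  have a: "a \<notin> cfun.span B" using insert.prems(1) insert.hyps by (simp add: cfun.independent_insert)
  define q where "q k = (\<integral>x. cnj (b k x) * a x \<partial>M)" for k
  define p where "p = (\<lambda>x. \<Sum>k<n. q k * b k x)"
  have p: "p \<in> cfun.span B" unfolding p_def by (intro cfun_span_sum) (simp add: b)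
  define r where "r = a - p"
  have r: "r \<in> cfun.span (insert a B)"
    unfolding r_def using p sub by (intro cfun.span_diff) (auto intro: cfun.span_base)
  have "r \<noteq> 0" using a p by (auto simp: r_def)
  define N where "N = norm_L2 M r"
  have N: "N \<noteq> 0" using insert.prems(3)[OF r] \<open>r \<noteq> 0\<close> by (auto simp: N_def)
  define e where "e = cfun_scale (1 / of_real N) r"
  have ea: "e x = (a x - p x) / of_real N" for x by (simp add: e_def cfun_scale_def r_def)
  have e: "e \<in> cfun.span (insert a B)" unfolding e_def by (intro cfun.span_scale r)
  define b' where "b' = b(n := e)"
  have sq: "square_integrable M f" if "f \<in> cfun.span (insert a B)" for f
    using insert.prems(2) that by blast
  have bsq: "square_integrable M (b k)" if "k < n" for k using b(1) that by (simp add: orthonormal_family_def)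
  have orth: "(\<integral>x. cnj (b k x) * e x \<partial>M) = 0" if k: "k < n" for k
  proof -
    have "(\<integral>x. cnj (b k x) * e x \<partial>M) = (\<integral>x. (cnj (b k x) * a x - cnj (b k x) * p x) / of_real N \<partial>M)"
      by (simp add: ea algebra_simps diff_divide_distrib)
    also have "\<dots> = ((\<integral>x. cnj (b k x) * a x \<partial>M) - (\<integral>x. cnj (b k x) * p x \<partial>M)) / of_real N"
      using p sub k by (simp add: square_integrable_prod bsq sq cfun.span_base subset_iff)
    also have "(\<integral>x. cnj (b k x) * p x \<partial>M) = q k"
      unfolding p_def by (rule orthonormal_family_inner_sum[OF b(1) k])
    finally show ?thesis by (simp add: q_def)
  qed
  have orth': "(\<integral>x. cnj (e x) * b k x \<partial>M) = 0" if k: "k < n" for k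
  proof -
    have "(\<integral>x. cnj (e x) * b k x \<partial>M) = (\<integral>x. cnj (cnj (b k x) * e x) \<partial>M)"
      by (simp add: mult.commute)
    also have "\<dots> = cnj (\<integral>x. cnj (b k x) * e x \<partial>M)" by (rule Bochner_Integration.integral_cnj)
    also have "\<dots> = 0" using orth[OF k] by (simp only: complex_cnj_zero)
    finally show ?thesis .
  qed
  have unit: "(\<integral>x. cnj (e x) * e x \<partial>M) = 1"
  proof -
    have "(\<integral>x. cnj (e x) * e x \<partial>M) = (\<integral>x. cnj (r x) * r x / of_real (N\<^sup>2) \<partial>M)"
      by (simp add: e_def cfun_scale_def power2_eq_square)
    also have "\<dots> = 1" using N by (simp add: norm_L2_sq[symmetric] N_def)
    finally show ?thesis .
  qed
  have card: "card (insert a B) = Suc n" using insert.hyps by (simp add: n_def)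
  have "orthonormal_family M (Suc n) b'"
    using b(1) bsq sq[OF e] orth orth' unit
    unfolding orthonormal_family_def b'_def by (auto simp: less_Suc_eq)
  moreover have "\<forall>k<Suc n. b' k \<in> cfun.span (insert a B)"
    using b(2) sub e by (auto simp: b'_def less_Suc_eq)
  moreover have "\<exists>c. f = (\<lambda>x. \<Sum>k<Suc n. c k * b' k x)" if "f \<in> cfun.span (insert a B)" for f
  proof -
    obtain z where z: "f - cfun_scale z a \<in> cfun.span B" using \<open>f \<in> _\<close> by (auto simp: cfun.span_breakdown_eq)
    obtain c where c: "f - cfun_scale z a = (\<lambda>x. \<Sum>k<n. c k * b k x)" using b(3)[OF z] by blast
    define c' where "c' = (\<lambda>k. c k + z * q k)(n := z * of_real N)"
    have "f x = (\<Sum>k<Suc n. c' k * b' k x)" for x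
    proof -
      have "f x = (\<Sum>k<n. c k * b k x) + z * a x"
        using fun_cong[OF c, of x] by (simp add: cfun_scale_def diff_eq_eq)
      also have "a x = p x + of_real N * e x" using N by (simp add: ea)
      finally show ?thesis
        by (simp add: c'_def b'_def p_def algebra_simps sum.distrib sum_distrib_left)
    qed
    then show ?thesis by blast
  qed
  ultimately show ?case unfolding card by blast
qed

lemma orthonormal_basis_exists:
  assumes "L2_function_space M m F"
  shows "\<exists>b. orthonormal_family M m b \<and> (\<forall>f\<in>F. \<exists>c. f = (\<lambda>x. \<Sum>k<m. c k * b k x))"
proof -
  have "\<exists>B. finite B \<and> card B = m \<and> cfun.independent B \<and> cfun.span B = F"
    using assms unfolding L2_function_space_def by (elim conjE)
  then obtain B where B: "finite B" "card B = m" "cfun.independent B" "cfun.span B = F"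
    by (elim exE conjE)
  have "\<exists>b. orthonormal_family M (card B) b \<and> (\<forall>k<card B. b k \<in> cfun.span B) \<and>
      (\<forall>f\<in>cfun.span B. \<exists>c. f = (\<lambda>x. \<Sum>k<card B. c k * b k x))"
    by (rule gram_schmidt_L2[OF B(1,3)]) (use assms B(4) in \<open>auto simp: L2_function_space_def\<close>)
  then show ?thesis unfolding B(2,4) by blast
qed

text \<open>The \<open>m\<^sup>2\<close> real functions that have to be integrated exactly are the real parts of the products
  \<open>cnj (b j) * b k\<close> with \<open>j \<le> k\<close> and the imaginary parts of those with \<open>j > k\<close>; the other parts
  follow by conjugation.\<close>

lemma orthonormal_quadrature:
  assumes "orthonormal_family M m b"
  shows "\<exists>T w. finite T \<and> T \<subseteq> space M \<and> card T \<le> m\<^sup>2 \<and> (\<forall>x\<in>T. 0 < w x) \<and>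
    (\<forall>j<m. \<forall>k<m. (\<Sum>x\<in>T. of_real (w x) * (cnj (b j x) * b k x)) = (if j = k then 1 else (0::complex)))"
proof -
  define h where "h j k x = cnj (b j x) * b k x" for j k x
  define g where "g x = (\<lambda>(j, k). if j \<le> k then Re (h j k x) else Im (h j k x))" for x
  let ?K = "{..<m} \<times> {..<m}"
  have int: "integrable M (h j k)" if "j < m" "k < m" for j k
    unfolding h_def using assms that by (intro square_integrable_prod) (auto simp: orthonormal_family_def)
  have K: "finite ?K" "card ?K = m\<^sup>2" by (auto simp: power2_eq_square)
  have gint: "integrable M (\<lambda>x. g x p)" if "p \<in> ?K" for p
    using int that unfolding g_def
    by (cases "fst p \<le> snd p") (auto intro!: Bochner_Integration.integrable_Re Bochner_Integration.integrable_Im)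
  obtain T w where T: "finite T" "T \<subseteq> space M" "card T \<le> card ?K" "\<And>x. x \<in> T \<Longrightarrow> 0 < w x"
    and q: "\<And>p. p \<in> ?K \<Longrightarrow> (\<integral>x. g x p \<partial>M) = (\<Sum>x\<in>T. w x * g x p)"
    using exact_quadrature[where g = g, OF K(1) gint] by blast
  define S where "S j k = (\<Sum>x\<in>T. of_real (w x) * h j k x)" for j k
  have S_cnj: "S k j = cnj (S j k)" for j k by (simp add: S_def h_def mult_ac)
  have one: "(\<integral>x. h j k x \<partial>M) = (if j = k then 1 else 0)" if "j < m" "k < m" for j k
    using assms that by (simp add: orthonormal_family_def h_def)
  have le: "S j k = (if j = k then 1 else 0)" if "j \<le> k" "k < m" for j k
  proof (rule complex_eqI)
    have jm: "j < m" using that by simp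
    have "Re (S j k) = (\<integral>x. Re (h j k x) \<partial>M)"
      using q[of "(j, k)"] that jm by (simp add: g_def S_def)
    also have "\<dots> = Re (\<integral>x. h j k x \<partial>M)" using int[OF jm that(2)] by (rule Bochner_Integration.integral_Re)
    finally show "Re (S j k) = Re (if j = k then 1 else 0)" using one[OF jm that(2)] by simp
    show "Im (S j k) = Im (if j = k then 1 else 0)"
    proof (cases "j = k")
      case True
      then show ?thesis using S_cnj[of k k] by (simp add: complex_eq_iff)
    next
      case False
      then have "Im (S k j) = (\<integral>x. Im (h k j x) \<partial>M)"
        using q[of "(k, j)"] that jm by (simp add: g_def S_def)
      also have "\<dots> = Im (\<integral>x. h k j x \<partial>M)" using int[OF that(2) jm] by (rule Bochner_Integration.integral_Im)
      also have "\<dots> = 0" using one[OF that(2) jm] False by simp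
      finally show ?thesis using S_cnj[of j k] False by simp
    qed
  qed
  have "S j k = (if j = k then 1 else 0)" if "j < m" "k < m" for j k
    using le[of j k] le[of k j] S_cnj[of k j] that by (cases "j \<le> k") auto
  then show ?thesis using T unfolding K S_def h_def by (intro exI[of _ T] exI[of _ w]) auto
qed

lemma MZ_positive_of_set:
  assumes "finite T" "T \<subseteq> space M" "\<And>x. x \<in> T \<Longrightarrow> 0 < w x"
    and "\<And>f. f \<in> F \<Longrightarrow> (1 - \<epsilon>) * (norm_L2 M f)\<^sup>2 \<le> (\<Sum>x\<in>T. w x * (cmod (f x))\<^sup>2)"
    and "\<And>f. f \<in> F \<Longrightarrow> (\<Sum>x\<in>T. w x * (cmod (f x))\<^sup>2) \<le> (1 + \<epsilon>) * (norm_L2 M f)\<^sup>2"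
  shows "MZ_positive M F (card T) \<epsilon>"
proof -
  obtain x where x: "bij_betw x {0..<card T} T" using ex_bij_betw_nat_finite[OF assms(1)] by blast
  then have x: "bij_betw x {..<card T} T" by (simp add: lessThan_atLeast0)
  have "(\<Sum>i<card T. w (x i) * (cmod (f (x i)))\<^sup>2) = (\<Sum>y\<in>T. w y * (cmod (f y))\<^sup>2)" for f :: "'a \<Rightarrow> complex"
    by (rule sum.reindex_bij_betw[OF x])
  moreover have "x i \<in> T" if "i < card T" for i using x that by (auto simp: bij_betw_def)
  ultimately show ?thesis
    unfolding MZ_positive_def MZ_inequality_def using assms x
    by (intro exI[of _ x] exI[of _ "\<lambda>i. w (x i)"]) (auto simp: bij_betw_def)
qed

text \<open>Weighted evaluations at the points of an exact quadrature form a Parseval frame.  Taking all of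
  these points gives the bound \<open>m\<^sup>2\<close>, and sparsifying the frame gives a bound linear in \<open>m\<close>.\<close>

lemma
  assumes "L2_function_space M m F" "0 \<le> \<epsilon>"
  shows MZ_positive_square: "\<exists>n\<le>m\<^sup>2. MZ_positive M F n \<epsilon>"
    and MZ_positive_sparse: "0 < \<epsilon> \<Longrightarrow> \<epsilon> < 1 \<Longrightarrow> 0 < m \<Longrightarrow> 4 * real m / \<epsilon>\<^sup>2 \<le> real N \<Longrightarrow> \<exists>n\<le>N. MZ_positive M F n \<epsilon>"
proof -
  obtain b where b: "orthonormal_family M m b" "\<forall>f\<in>F. \<exists>c. f = (\<lambda>x. \<Sum>k<m. c k * b k x)"
    using orthonormal_basis_exists[OF assms(1)] by (elim exE conjE)
  obtain T w where T0: "finite T" "T \<subseteq> space M" "card T \<le> m\<^sup>2" "\<forall>x\<in>T. 0 < w x"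
    and orth0: "\<forall>j<m. \<forall>k<m. (\<Sum>x\<in>T. of_real (w x) * (cnj (b j x) * b k x)) = (if j = k then 1 else (0::complex))"
    using orthonormal_quadrature[OF b(1)] by (elim exE conjE)
  note T = T0(1-3) T0(4)[rule_format] and orth = orth0[rule_format]
  define v where "v x k = of_real (sqrt (w x)) * cnj (b k x)" for x k
  have ip: "cip m (v x) c = of_real (sqrt (w x)) * (\<Sum>k<m. c k * b k x)" for x c
    unfolding cip_def v_def by (simp add: sum_distrib_left mult_ac)
  have ip2: "(cmod (cip m (v x) c))\<^sup>2 = w x * (cmod (\<Sum>k<m. c k * b k x))\<^sup>2" if "x \<in> T" for x c
    unfolding ip using T(4)[OF that] by (simp add: norm_mult power_mult_distrib)
  interpret parseval_frame m T v
  proof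
    fix c d
    have sq: "complex_of_real (sqrt (w x)) * of_real (sqrt (w x)) = of_real (w x)" if "x \<in> T" for x
      using T(4)[OF that] by (simp flip: of_real_mult)
    have "cip m c (v x) * cip m (v x) d
        = (\<Sum>j<m. \<Sum>k<m. cnj (c j) * d k * (of_real (w x) * (cnj (b j x) * b k x)))" if "x \<in> T" for x
    proof -
      have "cip m c (v x) * cip m (v x) d
          = (\<Sum>j<m. \<Sum>k<m. cnj (c j) * d k * ((of_real (sqrt (w x)) * of_real (sqrt (w x))) * (cnj (b j x) * b k x)))"
        unfolding cip_def v_def sum_product by (simp add: mult_ac)
      then show ?thesis unfolding sq[OF that] .
    qed
    then have "(\<Sum>x\<in>T. cip m c (v x) * cip m (v x) d)
        = (\<Sum>x\<in>T. \<Sum>j<m. \<Sum>k<m. cnj (c j) * d k * (of_real (w x) * (cnj (b j x) * b k x)))" by simp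
    also have "\<dots> = (\<Sum>j<m. \<Sum>x\<in>T. \<Sum>k<m. cnj (c j) * d k * (of_real (w x) * (cnj (b j x) * b k x)))"
      by (rule sum.swap)
    also have "\<dots> = (\<Sum>j<m. \<Sum>k<m. \<Sum>x\<in>T. cnj (c j) * d k * (of_real (w x) * (cnj (b j x) * b k x)))"
      by (intro sum.cong refl sum.swap)
    also have "\<dots> = (\<Sum>j<m. \<Sum>k<m. if k = j then cnj (c j) * d k else 0)"
      by (intro sum.cong refl) (auto simp: sum_distrib_left[symmetric] orth)
    also have "\<dots> = cip m c d" by (simp add: cip_def)
    finally show "cip m c d = (\<Sum>x\<in>T. cip m c (v x) * cip m (v x) d)" by simp
  qed (rule T)
  have sq: "square_integrable M f" if "f \<in> F" for f using assms(1) that by (simp add: L2_function_space_def)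
  have norm: "(norm_L2 M f)\<^sup>2 = sqnorm m c" if "f \<in> F" "f = (\<lambda>x. \<Sum>k<m. c k * b k x)" for f c
    using orthonormal_family_norm[OF b(1) sq[OF that(1)] that(2)] .
  have exact: "(\<Sum>x\<in>T. w x * (cmod (f x))\<^sup>2) = (norm_L2 M f)\<^sup>2" if "f \<in> F" for f
  proof -
    obtain c where c: "f = (\<lambda>x. \<Sum>k<m. c k * b k x)" using bspec[OF b(2) \<open>f \<in> F\<close>] by (elim exE)
    have "of_real (sqnorm m c) = complex_of_real (\<Sum>x\<in>T. (cmod (cip m (v x) c))\<^sup>2)"
      unfolding cip_self[symmetric] parseval[of c c] of_real_sum
      by (intro sum.cong refl, subst mult.commute, rule cip_mult_cnj)
    then have "sqnorm m c = (\<Sum>x\<in>T. (cmod (cip m (v x) c))\<^sup>2)" by (simp only: of_real_eq_iff)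
    then show ?thesis unfolding norm[OF that c] using ip2 by (simp add: c)
  qed
  have "MZ_positive M F (card T) \<epsilon>"
    by (rule MZ_positive_of_set[where w = w]) (use T assms(2) in \<open>auto simp: exact distrib_right left_diff_distrib\<close>)
  then show "\<exists>n\<le>m\<^sup>2. MZ_positive M F n \<epsilon>" using T(3) by blast
  assume "0 < \<epsilon>" "\<epsilon> < 1" "0 < m" "4 * real m / \<epsilon>\<^sup>2 \<le> real N"
  from frame_sparsification[OF this(3,1,2,4)]
  obtain s where s: "\<forall>i. 0 \<le> s i" "card {i \<in> T. 0 < s i} \<le> N"
    "\<forall>x. (1 - \<epsilon>) * sqnorm m x \<le> (\<Sum>i\<in>T. s i * (cmod (cip m (v i) x))\<^sup>2) \<and>
      (\<Sum>i\<in>T. s i * (cmod (cip m (v i) x))\<^sup>2) \<le> (1 + \<epsilon>) * sqnorm m x"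
    by (elim exE conjE)
  have "MZ_positive M F (card {i \<in> T. 0 < s i}) \<epsilon>"
  proof (rule MZ_positive_of_set[where w = "\<lambda>x. s x * w x"])
    fix f assume f: "f \<in> F"
    obtain c where c: "f = (\<lambda>x. \<Sum>k<m. c k * b k x)" using bspec[OF b(2) f] by (elim exE)
    have "(\<Sum>i\<in>T. s i * (cmod (cip m (v i) c))\<^sup>2) = (\<Sum>i\<in>T. s i * w i * (cmod (f i))\<^sup>2)"
      using ip2 by (intro sum.cong) (auto simp: c)
    also have "\<dots> = (\<Sum>i\<in>{i \<in> T. 0 < s i}. s i * w i * (cmod (f i))\<^sup>2)"
      using T(1) s(1) by (intro sum.mono_neutral_right) (auto simp: order.order_iff_strict)
    finally show "(1 - \<epsilon>) * (norm_L2 M f)\<^sup>2 \<le> (\<Sum>i\<in>{i \<in> T. 0 < s i}. s i * w i * (cmod (f i))\<^sup>2)"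
      "(\<Sum>i\<in>{i \<in> T. 0 < s i}. s i * w i * (cmod (f i))\<^sup>2) \<le> (1 + \<epsilon>) * (norm_L2 M f)\<^sup>2"
      unfolding norm[OF f c] using spec[OF s(3), of c] by simp_all
  qed (use T in auto)
  then show "\<exists>n\<le>N. MZ_positive M F n \<epsilon>" using s(2) by blast
qed

lemma MZ_number_le:
  assumes "\<And>(M :: 'a measure) F. L2_function_space M m F \<Longrightarrow> \<exists>n\<le>N. MZ_positive M F n \<epsilon>"
  shows "MZ_number TYPE('a) m \<epsilon> \<le> enat N"
  unfolding MZ_number_def
proof (rule Sup_least)
  fix z assume "z \<in> {MZ_min_points M F \<epsilon> | (M :: 'a measure) F. L2_function_space M m F}"
  then obtain M :: "'a measure" and F where z: "z = MZ_min_points M F \<epsilon>" "L2_function_space M m F" by blast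
  obtain n where n: "n \<le> N" "MZ_positive M F n \<epsilon>" using assms[OF z(2)] by blast
  have "z \<le> enat n" unfolding z MZ_min_points_def using n by (intro Inf_lower) auto
  then show "z \<le> enat N" using n(1) by (metis enat_ord_simps(1) order_trans)
qed

section \<open>Extremal function spaces\<close>

text \<open>Linear combinations of functions \<open>h 0, \<dots>, h (m - 1)\<close>, their linear independence on a set
  \<open>P\<close>, and the Marcinkiewicz--Zygmund inequality on their span for the counting measure on a finite
  set \<open>P\<close>.  In the latter, points that are not used have weight \<open>0\<close>.\<close>

definition lin_comb :: "nat \<Rightarrow> (nat \<Rightarrow> 'p \<Rightarrow> complex) \<Rightarrow> (nat \<Rightarrow> complex) \<Rightarrow> 'p \<Rightarrow> complex" where
  "lin_comb m h c p = (\<Sum>k<m. c k * h k p)"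

definition lin_indep_on :: "'p set \<Rightarrow> nat \<Rightarrow> (nat \<Rightarrow> 'p \<Rightarrow> complex) \<Rightarrow> bool" where
  "lin_indep_on P m h \<longleftrightarrow> (\<forall>c. (\<forall>p\<in>P. lin_comb m h c p = 0) \<longrightarrow> (\<forall>k<m. c k = 0))"

definition discrete_MZ :: "'p set \<Rightarrow> nat \<Rightarrow> (nat \<Rightarrow> 'p \<Rightarrow> complex) \<Rightarrow> real \<Rightarrow> ('p \<Rightarrow> real) \<Rightarrow> bool" where
  "discrete_MZ P m h \<epsilon> W \<longleftrightarrow> (\<forall>p\<in>P. 0 \<le> W p) \<and>
     (\<forall>c. (1 - \<epsilon>) * (\<Sum>p\<in>P. (cmod (lin_comb m h c p))\<^sup>2) \<le> (\<Sum>p\<in>P. W p * (cmod (lin_comb m h c p))\<^sup>2) \<and>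
          (\<Sum>p\<in>P. W p * (cmod (lin_comb m h c p))\<^sup>2) \<le> (1 + \<epsilon>) * (\<Sum>p\<in>P. (cmod (lin_comb m h c p))\<^sup>2))"

text \<open>Linearly independent functions on a finite set give a function space over the counting measure
  on any injective image of the set, and its Marcinkiewicz--Zygmund inequalities restrict to discrete
  ones.\<close>

lemma finite_example:
  fixes \<psi> :: "'p \<Rightarrow> 'a" and h :: "nat \<Rightarrow> 'p \<Rightarrow> complex"
  assumes "finite P" "inj_on \<psi> P" "lin_indep_on P m h"
  shows "\<exists>(M :: 'a measure) F. L2_function_space M m F \<and>
    (\<forall>n \<epsilon>. MZ_positive M F n \<epsilon> \<longrightarrow> (\<exists>W. discrete_MZ P m h \<epsilon> W \<and> card {p \<in> P. 0 < W p} \<le> n))"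
proof -
  define M where "M = count_space (\<psi> ` P)"
  define b where "b k x = (if x \<in> \<psi> ` P then h k (inv_into P \<psi> x) else 0)" for k x
  define B where "B = b ` {..<m}"
  define F where "F = cfun.span B"
  have b: "b k (\<psi> p) = h k p" if "p \<in> P" for k p
    using that assms(2) by (simp add: b_def)
  define E where "E c = (\<lambda>x. \<Sum>k<m. c k * b k x)" for c
  have E: "E c (\<psi> p) = lin_comb m h c p" if "p \<in> P" for c p
    using that by (simp add: E_def lin_comb_def b)
  have indep: "\<forall>k<m. c k = 0" if "E c = 0" for c
  proof -
    have "\<forall>p\<in>P. lin_comb m h c p = 0" using E that by (metis zero_fun_apply)
    then show ?thesis using assms(3) by (simp add: lin_indep_on_def)
  qed
  have inj: "inj_on b {..<m}"
  proof (rule inj_onI, rule ccontr)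
    fix i j assume ij: "i \<in> {..<m}" "j \<in> {..<m}" "b i = b j" "i \<noteq> j"
    define c :: "nat \<Rightarrow> complex" where "c k = (if k = i then 1 else 0) - (if k = j then 1 else 0)" for k
    have "E c x = b i x - b j x" for x
    proof -
      have "E c x = (\<Sum>k<m. (if k = i then b k x else 0) - (if k = j then b k x else 0))"
        unfolding E_def c_def by (intro sum.cong) auto
      then show ?thesis using ij by (simp add: sum_subtractf)
    qed
    then have "E c = 0" using ij by (simp add: fun_eq_iff)
    from indep[OF this] ij have "c i = 0" by simp
    then show False using ij by (simp add: c_def)
  qed
  have sumB: "(\<Sum>v\<in>B. cfun_scale (u v) v) = E (\<lambda>k. u (b k))" for u
  proof -
    have "(\<Sum>v\<in>B. cfun_scale (u v) v) = (\<Sum>k<m. cfun_scale (u (b k)) (b k))"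
      unfolding B_def by (simp add: sum.reindex[OF inj])
    then show ?thesis by (simp add: sum_cfun_scale E_def)
  qed
  have finB: "finite B" by (simp add: B_def)
  have F_iff: "f \<in> F \<longleftrightarrow> (\<exists>c. f = E c)" for f
  proof
    assume "f \<in> F"
    then show "\<exists>c. f = E c" unfolding F_def cfun.span_finite[OF finB] sumB by blast
  next
    assume "\<exists>c. f = E c"
    moreover have "E c \<in> F" for c
      unfolding F_def E_def by (rule cfun_span_sum) (auto intro: cfun.span_base simp: B_def)
    ultimately show "f \<in> F" by blast
  qed
  have "cfun.independent B"
    unfolding cfun.dependent_finite[OF finB] sumB using indep by (auto simp: B_def)
  moreover have "card B = m" using inj by (simp add: B_def card_image)
  moreover have sq: "square_integrable M f" for f :: "'a \<Rightarrow> complex"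
    unfolding square_integrable_def M_def using assms(1) by (simp add: integrable_count_space)
  have norm: "(norm_L2 M f)\<^sup>2 = (\<Sum>p\<in>P. (cmod (f (\<psi> p)))\<^sup>2)" for f :: "'a \<Rightarrow> complex"
    unfolding norm_L2_def M_def using assms(1,2)
    by (simp add: lebesgue_integral_count_space_finite sum.reindex sum_nonneg)
  have out: "f x = 0" if "f \<in> F" "x \<notin> \<psi> ` P" for f x
    using that by (auto simp: F_iff E_def b_def)
  have "f = 0" if "f \<in> F" "norm_L2 M f = 0" for f
  proof
    fix x
    have "\<forall>p\<in>P. f (\<psi> p) = 0" using norm[of f] that(2) assms(1) by (simp add: sum_nonneg_eq_0_iff)
    then show "f x = 0 x" using out[OF that(1)] by (cases "x \<in> \<psi> ` P") auto
  qed
  ultimately have space: "L2_function_space M m F"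
    unfolding L2_function_space_def using finB out sq
    by (auto simp: F_def M_def cfun.subspace_span)
  have "\<exists>W. discrete_MZ P m h \<epsilon> W \<and> card {p \<in> P. 0 < W p} \<le> n" if "MZ_positive M F n \<epsilon>" for n \<epsilon>
  proof -
    obtain x w where x: "\<forall>i<n. x i \<in> space M" "\<forall>i<n. 0 < w i" "MZ_inequality M F \<epsilon> n x w"
      using \<open>MZ_positive M F n \<epsilon>\<close> unfolding MZ_positive_def by (elim exE conjE)
    define y where "y i = inv_into P \<psi> (x i)" for i
    have y: "y i \<in> P" "\<psi> (y i) = x i" if "i < n" for i
      using x(1) that by (auto simp: y_def M_def inv_into_into f_inv_into_f)
    define W where "W p = (\<Sum>i<n. if y i = p then w i else 0)" for p
    have W0: "0 \<le> W p" for p unfolding W_def using x(2) by (intro sum_nonneg) (auto intro: less_imp_le)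
    have WE: "(\<Sum>p\<in>P. W p * (cmod (lin_comb m h c p))\<^sup>2) = (\<Sum>i<n. w i * (cmod (E c (x i)))\<^sup>2)" for c
    proof -
      have "(\<Sum>p\<in>P. W p * (cmod (lin_comb m h c p))\<^sup>2)
          = (\<Sum>p\<in>P. \<Sum>i<n. if y i = p then w i * (cmod (lin_comb m h c p))\<^sup>2 else 0)"
        unfolding W_def sum_distrib_right by (intro sum.cong) auto
      also have "\<dots> = (\<Sum>i<n. \<Sum>p\<in>P. if y i = p then w i * (cmod (lin_comb m h c p))\<^sup>2 else 0)"
        by (rule sum.swap)
      also have "\<dots> = (\<Sum>i<n. w i * (cmod (E c (x i)))\<^sup>2)"
        using assms(1) y by (intro sum.cong) (auto simp: E[symmetric])
      finally show ?thesis .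
    qed
    have "discrete_MZ P m h \<epsilon> W"
      unfolding discrete_MZ_def WE
    proof (intro conjI ballI allI)
      fix c
      have "E c \<in> F" by (auto simp: F_iff)
      moreover have "(norm_L2 M (E c))\<^sup>2 = (\<Sum>p\<in>P. (cmod (lin_comb m h c p))\<^sup>2)" unfolding norm by (simp add: E)
      ultimately show "(1 - \<epsilon>) * (\<Sum>p\<in>P. (cmod (lin_comb m h c p))\<^sup>2) \<le> (\<Sum>i<n. w i * (cmod (E c (x i)))\<^sup>2)"
        "(\<Sum>i<n. w i * (cmod (E c (x i)))\<^sup>2) \<le> (1 + \<epsilon>) * (\<Sum>p\<in>P. (cmod (lin_comb m h c p))\<^sup>2)"
        using x(3) unfolding MZ_inequality_def by metis+
    qed (rule W0)
    moreover have "{p \<in> P. 0 < W p} \<subseteq> y ` {..<n}"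
    proof
      fix p assume "p \<in> {p \<in> P. 0 < W p}"
      then have "W p \<noteq> 0" by simp
      then obtain i where "i \<in> {..<n}" "(if y i = p then w i else 0) \<noteq> 0"
        unfolding W_def by (rule sum.not_neutral_contains_not_neutral)
      then show "p \<in> y ` {..<n}" by (auto split: if_splits)
    qed
    then have "card {p \<in> P. 0 < W p} \<le> n"
      using surj_card_le[of "{..<n}"] by simp
    ultimately show ?thesis by blast
  qed
  then show ?thesis using space by blast
qed

lemma MZ_number_ge:
  fixes P :: "(nat \<times> nat) set"
  assumes "infinite (UNIV :: 'a set)" "finite P" "lin_indep_on P m h"
    and "\<And>W. discrete_MZ P m h \<epsilon> W \<Longrightarrow> N \<le> card {p \<in> P. 0 < W p}"
  shows "enat N \<le> MZ_number TYPE('a) m \<epsilon>"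
proof -
  obtain g :: "nat \<Rightarrow> 'a" where g: "inj g"
    using infinite_countable_subset[OF assms(1)] by auto
  have "inj_on (g \<circ> prod_encode) P"
    using g inj_prod_encode by (metis comp_inj_on inj_on_subset subset_UNIV)
  then obtain M :: "'a measure" and F where MF: "L2_function_space M m F"
    "\<forall>n \<epsilon>. MZ_positive M F n \<epsilon> \<longrightarrow> (\<exists>W. discrete_MZ P m h \<epsilon> W \<and> card {p \<in> P. 0 < W p} \<le> n)"
    using finite_example[OF assms(2) _ assms(3)] by blast
  have "enat N \<le> MZ_min_points M F \<epsilon>"
    unfolding MZ_min_points_def
  proof (rule Inf_greatest)
    fix z assume "z \<in> {enat n | n. MZ_positive M F n \<epsilon>}"
    then obtain n where n: "z = enat n" "MZ_positive M F n \<epsilon>" by blast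
    have "\<exists>W. discrete_MZ P m h \<epsilon> W \<and> card {p \<in> P. 0 < W p} \<le> n" using MF(2) n(2) by simp
    then obtain W where W: "discrete_MZ P m h \<epsilon> W" "card {p \<in> P. 0 < W p} \<le> n" by (elim exE conjE)
    show "enat N \<le> z" using assms(4)[OF W(1)] W(2) n(1) by simp
  qed
  also have "\<dots> \<le> MZ_number TYPE('a) m \<epsilon>"
    unfolding MZ_number_def using MF(1) by (intro Sup_upper) blast
  finally show ?thesis .
qed

lemma discrete_MZ_card_ge:
  assumes "finite P" "lin_indep_on P m h" "discrete_MZ P m h \<epsilon> W" "\<epsilon> < 1"
  shows "m \<le> card {p \<in> P. 0 < W p}"
proof (rule ccontr)
  assume "\<not> ?thesis"
  then have less: "card {p \<in> P. 0 < W p} < card {..<m}" by simp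
  obtain c where c: "\<exists>k\<in>{..<m}. c k \<noteq> 0" "\<And>p. p \<in> P \<Longrightarrow> 0 < W p \<Longrightarrow> lin_comb m h c p = 0"
    using exists_nontrivial_relation[OF _ _ less, of h] assms(1) by (auto simp: lin_comb_def)
  have "(\<Sum>p\<in>P. W p * (cmod (lin_comb m h c p))\<^sup>2) = 0"
    using c(2) assms(3) by (intro sum.neutral) (auto simp: discrete_MZ_def less_le)
  then have "(1 - \<epsilon>) * (\<Sum>p\<in>P. (cmod (lin_comb m h c p))\<^sup>2) \<le> 0"
    using assms(3) unfolding discrete_MZ_def by metis
  then have "(\<Sum>p\<in>P. (cmod (lin_comb m h c p))\<^sup>2) \<le> 0" using assms(4) by (simp add: mult_le_0_iff)
  then have "(\<Sum>p\<in>P. (cmod (lin_comb m h c p))\<^sup>2) = 0" by (simp add: sum_nonneg antisym)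
  then have "\<forall>p\<in>P. lin_comb m h c p = 0" using assms(1) by (simp add: sum_nonneg_eq_0_iff)
  then show False using assms(2) c(1) by (auto simp: lin_indep_on_def)
qed

text \<open>The \<open>k\<close>-th coordinate of the vectors \<open>e\<^sub>i\<close> at the point \<open>(i, i)\<close>, \<open>e\<^sub>i + e\<^sub>j\<close> at \<open>(i, j)\<close> for
  \<open>i < j\<close>, and \<open>e\<^sub>i + \<i> e\<^sub>j\<close> at \<open>(i, j)\<close> for \<open>i > j\<close>.  The squared moduli of the inner products
  with these \<open>m\<^sup>2\<close> vectors determine a Hermitian form.\<close>

definition tomography_fun :: "nat \<Rightarrow> nat \<times> nat \<Rightarrow> complex" where
  "tomography_fun k = (\<lambda>(i, j). if i = j then (if k = i then 1 else 0)
     else (if k = i then 1 else 0) + (if k = j then (if i < j then 1 else \<i>) else 0))"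

lemma lin_comb_delta:
  "l < m \<Longrightarrow> lin_comb m h (\<lambda>k. if k = l then z else 0) p = z * h l p"
proof -
  assume "l < m"
  have "lin_comb m h (\<lambda>k. if k = l then z else 0) p = (\<Sum>k<m. if k = l then z * h k p else 0)"
    unfolding lin_comb_def by (intro sum.cong) auto
  then show ?thesis using \<open>l < m\<close> by simp
qed

lemma lin_comb_add: "lin_comb m h (\<lambda>k. c k + d k) p = lin_comb m h c p + lin_comb m h d p"
  by (simp add: lin_comb_def distrib_right sum.distrib)

lemma tomography_indep: "lin_indep_on ({..<m} \<times> {..<m}) m tomography_fun"
  unfolding lin_indep_on_def
proof (intro allI impI)
  fix c k assume z: "\<forall>p\<in>{..<m} \<times> {..<m}. lin_comb m tomography_fun c p = 0" and k: "k < m"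
  have "lin_comb m tomography_fun c (k, k) = (\<Sum>l<m. if l = k then c l else 0)"
    unfolding lin_comb_def tomography_fun_def by (intro sum.cong) auto
  then show "c k = 0" using z k by simp
qed

text \<open>By polarization, the deviations \<open>D\<close> of the weights from \<open>1\<close> annihilate every product of two
  coordinate functions.  For distinct coordinates \<open>i\<close> and \<open>j\<close> the product is supported on
  \<open>(i, j)\<close> and \<open>(j, i)\<close>, with values of different phase, so both deviations vanish.\<close>

lemma tomography_exact:
  assumes "discrete_MZ ({..<m} \<times> {..<m}) m tomography_fun 0 W"
  shows "m\<^sup>2 \<le> card {p \<in> {..<m} \<times> {..<m}. 0 < W p}"
proof -
  let ?P = "{..<m} \<times> {..<m}" and ?h = tomography_fun
  define D where "D p = W p - 1" for p
  have H: "(\<Sum>p\<in>?P. D p * (cmod (lin_comb m ?h c p))\<^sup>2) = 0" for c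
    using assms unfolding discrete_MZ_def D_def
    by (simp add: left_diff_distrib sum_subtractf antisym)
  have pol: "(\<Sum>p\<in>?P. of_real (D p) * (cnj (?h i p) * ?h j p)) = 0" if "i < m" "j < m" for i j
  proof -
    define S where "S = (\<Sum>p\<in>?P. of_real (D p) * (cnj (?h i p) * ?h j p))"
    have "Re (z * S) = 0" for z
    proof -
      define c :: "nat \<Rightarrow> complex" where "c k = (if k = i then 1 else 0)" for k
      define d where "d k = (if k = j then z else 0)" for k
      have cd: "lin_comb m ?h c p = ?h i p" "lin_comb m ?h d p = z * ?h j p" for p
        using that by (simp_all add: c_def[abs_def] d_def[abs_def] lin_comb_delta)
      have "(cmod (lin_comb m ?h (\<lambda>k. c k + d k) p))\<^sup>2 = (cmod (lin_comb m ?h c p))\<^sup>2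
          + (cmod (lin_comb m ?h d p))\<^sup>2 + 2 * Re (z * (cnj (?h i p) * ?h j p))" for p
        unfolding lin_comb_add cd cmod_power2 by (simp add: power2_eq_square algebra_simps)
      moreover have re: "Re (z * (of_real (D p) * a)) = D p * Re (z * a)" for p a
        by (simp add: algebra_simps)
      ultimately have "(\<Sum>p\<in>?P. D p * (cmod (lin_comb m ?h (\<lambda>k. c k + d k) p))\<^sup>2)
          = (\<Sum>p\<in>?P. D p * (cmod (lin_comb m ?h c p))\<^sup>2) + (\<Sum>p\<in>?P. D p * (cmod (lin_comb m ?h d p))\<^sup>2)
            + (\<Sum>p\<in>?P. 2 * Re (z * (of_real (D p) * (cnj (?h i p) * ?h j p))))"
        unfolding sum.distrib[symmetric] by (intro sum.cong refl) (simp only: re distrib_left mult.left_commute[of 2])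
      then have "(\<Sum>p\<in>?P. 2 * Re (z * (of_real (D p) * (cnj (?h i p) * ?h j p)))) = 0"
        unfolding H by simp
      then show ?thesis unfolding S_def sum_distrib_left Re_sum by (simp only: sum_distrib_left[symmetric] mult_eq_0_iff) simp
    qed
    from this[of 1] this[of \<i>] have "S = 0" by (simp add: complex_eq_iff)
    then show ?thesis by (simp add: S_def)
  qed
  have off: "D (i, j) = 0 \<and> D (j, i) = 0" if "i < j" "j < m" for i j
  proof -
    have "(\<Sum>p\<in>?P. of_real (D p) * (cnj (?h i p) * ?h j p))
        = (\<Sum>p\<in>{(i, j), (j, i)}. of_real (D p) * (cnj (?h i p) * ?h j p))"
      using that by (intro sum.mono_neutral_right) (auto simp: tomography_fun_def split: if_splits)
    also have "\<dots> = of_real (D (i, j)) - \<i> * of_real (D (j, i))"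
      using that by (simp add: tomography_fun_def)
    finally show ?thesis using pol[of i j] that by (simp add: complex_eq_iff)
  qed
  have off': "D (i, j) = 0" if "i \<noteq> j" "i < m" "j < m" for i j
    using off[of i j] off[of j i] that by (metis linorder_neqE_nat)
  have diag: "D (i, i) = 0" if "i < m" for i
  proof -
    have "(\<Sum>p\<in>?P. of_real (D p) * (cnj (?h i p) * ?h i p))
        = (\<Sum>p\<in>{(i, i)}. of_real (D p) * (cnj (?h i p) * ?h i p))"
      using that off' by (intro sum.mono_neutral_right) (auto simp: tomography_fun_def split: if_splits)
    then show ?thesis using pol[OF that that] by (simp add: tomography_fun_def)
  qed
  have "W p = 1" if "p \<in> ?P" for p
    using that off' diag by (cases p) (metis D_def eq_iff_diff_eq_0 lessThan_iff mem_Sigma_iff)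
  then have "{p \<in> ?P. 0 < W p} = ?P" by auto
  then show ?thesis by (simp add: power2_eq_square)
qed

text \<open>The edges of the complete graph on the vertices \<open>0, \<dots>, m\<close>, with the larger endpoint first.\<close>

definition edge_pairs :: "nat \<Rightarrow> (nat \<times> nat) set" where
  "edge_pairs m = Sigma {..m} (\<lambda>j. {..<j})"

lemma sum_edge_pairs:
  fixes f :: "nat \<Rightarrow> nat \<Rightarrow> real"
  assumes "\<And>i j. f i j = f j i" "\<And>i. f i i = 0"
  shows "(\<Sum>i\<le>m. \<Sum>j\<le>m. f i j) = 2 * (\<Sum>(j, i)\<in>edge_pairs m. f j i)"
proof -
  have "(\<Sum>i\<le>m. \<Sum>j\<le>m. f i j) = 2 * (\<Sum>j\<le>m. \<Sum>i<j. f j i)"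
  proof (induction m)
    case 0
    then show ?case using assms(2) by simp
  next
    case (Suc m)
    have "(\<Sum>i\<le>m. f i (Suc m)) = (\<Sum>i<Suc m. f (Suc m) i)"
      using assms(1) by (simp add: lessThan_Suc_atMost)
    moreover have "(\<Sum>j\<le>m. f (Suc m) j) = (\<Sum>i<Suc m. f (Suc m) i)" by (simp add: lessThan_Suc_atMost)
    ultimately show ?case using Suc assms(2) by (simp add: sum.distrib)
  qed
  then show ?thesis unfolding edge_pairs_def by (simp add: sum.Sigma)
qed

text \<open>A weighted graph on \<open>m + 1\<close> vertices whose Laplacian form approximates that of the complete graph
  with relative error \<open>\<epsilon>\<close> has many edges.  Let \<open>D\<close> be the difference of the Laplacians.  The
  squared Hilbert--Schmidt norm of \<open>D\<close> is at most \<open>\<epsilon>\<^sup>2 m (m + 1)\<^sup>2\<close>, by estimating each row.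
  It can also be expressed through the vertex degrees and the squares of the weights, and both of
  these are bounded below by the Cauchy--Schwarz inequality in terms of the total weight \<open>S\<close>,
  the latter with a factor \<open>1 / n\<close>.  The result is a quadratic inequality in \<open>S\<close>, which is
  solvable only if its discriminant is nonnegative.\<close>

lemma complete_graph_sparsifier:
  fixes W :: "nat \<times> nat \<Rightarrow> real"
  assumes "0 < \<epsilon>" "\<epsilon> < 1" "0 < m"
    and W0: "\<And>p. p \<in> edge_pairs m \<Longrightarrow> 0 \<le> W p"
    and lower: "\<And>y. (1 - \<epsilon>) * (\<Sum>(j, i)\<in>edge_pairs m. (y j - y i)\<^sup>2) \<le> (\<Sum>(j, i)\<in>edge_pairs m. W (j, i) * (y j - y i)\<^sup>2)"
    and upper: "\<And>y. (\<Sum>(j, i)\<in>edge_pairs m. W (j, i) * (y j - y i)\<^sup>2) \<le> (1 + \<epsilon>) * (\<Sum>(j, i)\<in>edge_pairs m. (y j - y i)\<^sup>2)"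
  shows "real m * (real m + 1) * (1 - \<epsilon>\<^sup>2) / (2 * (1 + real m * \<epsilon>\<^sup>2)) \<le> real (card {p \<in> edge_pairs m. 0 < W p})"
proof -
  define n where "n = real (card {p \<in> edge_pairs m. 0 < W p})"
  define M where "M = real m + 1"
  have M: "0 < M" by (simp add: M_def)
  have finP: "finite (edge_pairs m)" by (simp add: edge_pairs_def)
  define d where "d i j = (if i = j then 0 else W (max i j, min i j) - 1)" for i j
  have d_sym: "d i j = d j i" and d_diag: "d i i = 0" for i j
    by (auto simp: d_def max.commute min.commute)
  have dW: "d j i = W (j, i) - 1" if "(j, i) \<in> edge_pairs m" for i j
    using that by (auto simp: d_def edge_pairs_def max_def min_def)
  define G where "G y = (\<Sum>i\<le>m. \<Sum>j\<le>m. (y i - y j)\<^sup>2)" for y :: "nat \<Rightarrow> real"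
  define Q where "Q y = (\<Sum>i\<le>m. \<Sum>j\<le>m. d i j * (y i - y j)\<^sup>2)" for y :: "nat \<Rightarrow> real"
  have GP: "G y = 2 * (\<Sum>(j, i)\<in>edge_pairs m. (y j - y i)\<^sup>2)" for y
    unfolding G_def by (rule sum_edge_pairs) (auto simp: power2_commute)
  have QP: "Q y = 2 * ((\<Sum>(j, i)\<in>edge_pairs m. W (j, i) * (y j - y i)\<^sup>2) - (\<Sum>(j, i)\<in>edge_pairs m. (y j - y i)\<^sup>2))" for y
  proof -
    have "Q y = 2 * (\<Sum>(j, i)\<in>edge_pairs m. d j i * (y j - y i)\<^sup>2)"
      unfolding Q_def by (rule sum_edge_pairs) (use d_sym d_diag in \<open>auto simp: power2_commute\<close>)
    also have "(\<Sum>(j, i)\<in>edge_pairs m. d j i * (y j - y i)\<^sup>2)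
        = (\<Sum>(j, i)\<in>edge_pairs m. W (j, i) * (y j - y i)\<^sup>2 - (y j - y i)\<^sup>2)"
      by (intro sum.cong) (auto simp: dW algebra_simps)
    also have "\<dots> = (\<Sum>(j, i)\<in>edge_pairs m. W (j, i) * (y j - y i)\<^sup>2) - (\<Sum>(j, i)\<in>edge_pairs m. (y j - y i)\<^sup>2)"
      by (simp add: sum_subtractf case_prod_unfold)
    finally show ?thesis .
  qed
  have Q_le: "Q y \<le> \<epsilon> * G y" "- (\<epsilon> * G y) \<le> Q y" for y
    unfolding GP QP using upper[of y] lower[of y] by (simp_all add: algebra_simps)
  have G_eq: "G y = 2 * (M * (\<Sum>i\<le>m. (y i)\<^sup>2) - (\<Sum>i\<le>m. y i)\<^sup>2)" for y
  proof -
    have "G y = (\<Sum>i\<le>m. \<Sum>j\<le>m. (y i)\<^sup>2 + (y j)\<^sup>2 - 2 * (y i * y j))"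
      unfolding G_def by (simp add: power2_diff mult.assoc)
    also have "\<dots> = 2 * (M * (\<Sum>i\<le>m. (y i)\<^sup>2)) - 2 * ((\<Sum>i\<le>m. y i) * (\<Sum>j\<le>m. y j))"
      unfolding sum_product by (simp add: sum.distrib sum_subtractf sum_distrib_left M_def distrib_right distrib_left)
    finally show ?thesis by (simp add: power2_eq_square)
  qed
  define \<delta> where "\<delta> k = (\<Sum>j\<le>m. d k j)" for k
  define Nk where "Nk k = (\<delta> k)\<^sup>2 + (\<Sum>j\<le>m. (d k j)\<^sup>2)" for k
  \<comment> \<open>The squared length of the \<open>k\<close>-th row of the error matrix, bounded by polarization.\<close>
  have row: "Nk k \<le> \<epsilon>\<^sup>2 * M * real m" if k: "k \<le> m" for k
  proof -
    define e where "e j = (if j = k then 1 else (0::real))" for j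
    define z where "z j = (if j = k then \<delta> k else - d k j)" for j
    \<comment> \<open>This scaling balances the two terms of the polarization estimate.\<close>
    define t where "t = 1 / (\<epsilon> * M)"
    have z2: "(\<Sum>j\<le>m. (z j)\<^sup>2) = Nk k"
    proof -
      have "(\<Sum>j\<le>m. (z j)\<^sup>2) = (\<Sum>j\<le>m. (if j = k then (\<delta> k)\<^sup>2 else 0) + (d k j)\<^sup>2)"
        by (intro sum.cong) (auto simp: z_def d_diag)
      then show ?thesis using k by (simp add: sum.distrib Nk_def)
    qed
    have Dez: "(\<Sum>i\<le>m. \<Sum>j\<le>m. d i j * ((e i - e j) * (z i - z j))) = 2 * Nk k"
    proof -
      have half: "(\<Sum>i\<le>m. \<Sum>j\<le>m. d i j * (e i * (z i - z j))) = Nk k"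
      proof -
        have "(\<Sum>i\<le>m. \<Sum>j\<le>m. d i j * (e i * (z i - z j)))
            = (\<Sum>i\<le>m. if i = k then (\<Sum>j\<le>m. d k j * (z k - z j)) else 0)"
          by (intro sum.cong) (auto simp: e_def)
        also have "\<dots> = (\<Sum>j\<le>m. d k j * (z k - z j))" using k by simp
        also have "\<dots> = (\<Sum>j\<le>m. d k j * \<delta> k + (d k j)\<^sup>2)"
          by (intro sum.cong) (auto simp: z_def d_diag power2_eq_square algebra_simps)
        also have "\<dots> = Nk k"
          by (simp add: sum.distrib Nk_def sum_distrib_right[symmetric] \<delta>_def[symmetric] power2_eq_square)
        finally show ?thesis .
      qed
      have "(\<Sum>i\<le>m. \<Sum>j\<le>m. d i j * (e j * (z j - z i))) = (\<Sum>j\<le>m. \<Sum>i\<le>m. d i j * (e j * (z j - z i)))"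
        by (rule sum.swap)
      also have "\<dots> = (\<Sum>j\<le>m. \<Sum>i\<le>m. d j i * (e j * (z j - z i)))" by (simp add: d_sym)
      finally have "(\<Sum>i\<le>m. \<Sum>j\<le>m. d i j * (e j * (z j - z i))) = Nk k" using half by simp
      with half have "(\<Sum>i\<le>m. \<Sum>j\<le>m. d i j * (e i * (z i - z j)) + d i j * (e j * (z j - z i))) = 2 * Nk k"
        by (simp add: sum.distrib)
      then show ?thesis by (simp add: algebra_simps)
    qed
    have "Q (\<lambda>j. e j + t * z j) - Q (\<lambda>j. e j - t * z j)
        = 4 * t * (\<Sum>i\<le>m. \<Sum>j\<le>m. d i j * ((e i - e j) * (z i - z j)))"
      unfolding Q_def sum_subtractf[symmetric] sum_distrib_left
      by (intro sum.cong refl) (simp add: power2_eq_square algebra_simps)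
    moreover have "G (\<lambda>j. e j + t * z j) + G (\<lambda>j. e j - t * z j) = 2 * G e + 2 * t\<^sup>2 * G z"
      unfolding G_def sum.distrib[symmetric] sum_distrib_left
      by (intro sum.cong refl) (simp add: power2_eq_square algebra_simps)
    moreover have "G z \<le> 2 * (M * Nk k)" unfolding G_eq z2 by simp
    then have "2 * t\<^sup>2 * G z \<le> 2 * t\<^sup>2 * (2 * (M * Nk k))" by (intro mult_left_mono) auto
    moreover have "G e = 2 * real m"
    proof -
      have "(\<Sum>i\<le>m. (e i)\<^sup>2) = (\<Sum>i\<le>m. if i = k then 1 else 0)" by (intro sum.cong) (auto simp: e_def)
      moreover have "(\<Sum>i\<le>m. e i) = 1" using k by (simp add: e_def)
      ultimately show ?thesis using k by (simp add: G_eq M_def)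
    qed
    ultimately have "Q (\<lambda>j. e j + t * z j) - Q (\<lambda>j. e j - t * z j) = 8 * t * Nk k"
      and G_le: "G (\<lambda>j. e j + t * z j) + G (\<lambda>j. e j - t * z j) \<le> 4 * real m + 4 * t\<^sup>2 * M * Nk k"
      unfolding Dez by simp_all
    then have "8 * t * Nk k \<le> \<epsilon> * (G (\<lambda>j. e j + t * z j) + G (\<lambda>j. e j - t * z j))"
      using Q_le(1)[of "\<lambda>j. e j + t * z j"] Q_le(2)[of "\<lambda>j. e j - t * z j"] unfolding distrib_left by linarith
    also have "\<dots> \<le> \<epsilon> * (4 * real m + 4 * t\<^sup>2 * M * Nk k)"
      using assms(1) by (intro mult_left_mono[OF G_le]) simp
    finally have "8 * t * Nk k \<le> \<epsilon> * (4 * real m + 4 * t\<^sup>2 * M * Nk k)" .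
    moreover have "\<epsilon> * (4 * t\<^sup>2 * M * Nk k) = 4 * t * Nk k"
      using assms(1) M by (simp add: t_def power2_eq_square)
    ultimately have "t * Nk k \<le> \<epsilon> * real m" by (simp add: distrib_left)
    then show ?thesis using assms(1) M by (simp add: t_def field_simps power2_eq_square)
  qed
  have total: "(\<Sum>k\<le>m. Nk k) \<le> M * (\<epsilon>\<^sup>2 * M * real m)"
  proof -
    have "(\<Sum>k\<le>m. Nk k) \<le> (\<Sum>k\<le>m. \<epsilon>\<^sup>2 * M * real m)" using row by (intro sum_mono) simp
    then show ?thesis by (simp add: M_def add.commute)
  qed
  define S where "S = (\<Sum>p\<in>edge_pairs m. W p)"
  define S2 where "S2 = (\<Sum>p\<in>edge_pairs m. (W p)\<^sup>2)"
  have cardP: "2 * real (card (edge_pairs m)) = M * real m"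
  proof -
    have "(\<Sum>i\<le>m. \<Sum>j\<le>m. if i = j then 0 else 1) = 2 * (\<Sum>(j, i)\<in>edge_pairs m. if j = i then 0 else (1::real))"
      by (rule sum_edge_pairs) auto
    also have "(\<Sum>(j, i)\<in>edge_pairs m. if j = i then 0 else (1::real)) = (\<Sum>p\<in>edge_pairs m. 1)"
      by (intro sum.cong) (auto simp: edge_pairs_def)
    also have "(\<Sum>i\<le>m. \<Sum>j\<le>m. if i = j then 0 else (1::real)) = (\<Sum>i\<le>m. \<Sum>j\<le>m. 1 - (if i = j then 1 else 0))"
      by (intro sum.cong) auto
    also have "\<dots> = M * real m" by (simp add: sum_subtractf M_def algebra_simps)
    finally show ?thesis by simp
  qed
  have sum_d: "(\<Sum>k\<le>m. \<delta> k) = 2 * S - M * real m"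
  proof -
    have "(\<Sum>k\<le>m. \<delta> k) = 2 * (\<Sum>(j, i)\<in>edge_pairs m. d j i)"
      unfolding \<delta>_def by (rule sum_edge_pairs) (auto simp: d_sym d_diag)
    also have "(\<Sum>(j, i)\<in>edge_pairs m. d j i) = (\<Sum>p\<in>edge_pairs m. W p - 1)"
      by (intro sum.cong) (auto simp: dW)
    also have "\<dots> = S - real (card (edge_pairs m))" by (simp add: sum_subtractf S_def)
    finally show ?thesis using cardP by simp
  qed
  have sum_d2: "(\<Sum>k\<le>m. \<Sum>j\<le>m. (d k j)\<^sup>2) = 2 * S2 - 4 * S + M * real m"
  proof -
    have "(\<Sum>k\<le>m. \<Sum>j\<le>m. (d k j)\<^sup>2) = 2 * (\<Sum>(j, i)\<in>edge_pairs m. (d j i)\<^sup>2)"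
      by (rule sum_edge_pairs) (auto simp: d_sym d_diag)
    also have "(\<Sum>(j, i)\<in>edge_pairs m. (d j i)\<^sup>2) = (\<Sum>p\<in>edge_pairs m. (W p)\<^sup>2 - 2 * W p + 1)"
      by (intro sum.cong) (auto simp: dW power2_eq_square algebra_simps)
    also have "\<dots> = S2 - 2 * S + real (card (edge_pairs m))"
      by (simp add: sum.distrib sum_subtractf S_def S2_def sum_distrib_left)
    finally show ?thesis using cardP by simp
  qed
  have "(2 * S - M * real m)\<^sup>2 \<le> (\<Sum>k\<le>m. (\<delta> k)\<^sup>2) * M"
    unfolding sum_d[symmetric] using sum_squared_le_sum_of_squares[of \<delta> "{..m}"] by (simp add: M_def add.commute)
  then have "(2 * S - M * real m)\<^sup>2 / M \<le> (\<Sum>k\<le>m. (\<delta> k)\<^sup>2)" using M by (simp add: field_simps)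
  moreover have "(\<Sum>k\<le>m. Nk k) = (\<Sum>k\<le>m. (\<delta> k)\<^sup>2) + (2 * S2 - 4 * S + M * real m)"
    unfolding Nk_def sum.distrib sum_d2 ..
  ultimately have "(2 * S - M * real m)\<^sup>2 / M + (2 * S2 - 4 * S + M * real m) \<le> M * (\<epsilon>\<^sup>2 * M * real m)"
    using total by linarith
  moreover have "(2 * S - M * real m)\<^sup>2 / M = 4 * S\<^sup>2 / M - 4 * real m * S + M * (real m)\<^sup>2"
    using M by (simp add: field_simps power2_eq_square)
  moreover have "4 * real m * S + 4 * S = 4 * M * S" "M * (real m)\<^sup>2 + M * real m = M\<^sup>2 * real m"
    by (simp_all add: M_def algebra_simps power2_eq_square)
  ultimately have main: "4 * S\<^sup>2 / M + 2 * S2 - 4 * M * S + M\<^sup>2 * (real m * (1 - \<epsilon>\<^sup>2)) \<le> 0"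
    by (simp add: algebra_simps power2_eq_square)
  have supp: "S\<^sup>2 \<le> S2 * n"
  proof -
    have "S = (\<Sum>p\<in>{p \<in> edge_pairs m. 0 < W p}. W p)"
      unfolding S_def using finP W0 by (intro sum.mono_neutral_right) (auto simp: less_le)
    then have "S\<^sup>2 \<le> (\<Sum>p\<in>{p \<in> edge_pairs m. 0 < W p}. (W p)\<^sup>2) * n"
      unfolding n_def using sum_squared_le_sum_of_squares by metis
    also have "\<dots> \<le> S2 * n" unfolding S2_def n_def
      using finP by (intro mult_right_mono sum_mono2) auto
    finally show ?thesis .
  qed
  have \<kappa>: "0 < 1 - \<epsilon>\<^sup>2" using assms(1,2) by (simp add: power_less_one_iff abs_less_iff)
  have pos: "0 < M\<^sup>2 * (real m * (1 - \<epsilon>\<^sup>2))" using M \<kappa> assms(3) by simp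
  have n0: "0 < n"
  proof (rule ccontr)
    assume "\<not> 0 < n"
    then have "n = 0" by (simp add: n_def)
    then have "S = 0" using supp by simp
    moreover have "0 \<le> S2" by (simp add: S2_def sum_nonneg)
    ultimately show False using main pos by simp
  qed
  define \<alpha> where "\<alpha> = 1 / M + 1 / (2 * n)"
  have \<alpha>: "0 < \<alpha>" unfolding \<alpha>_def using M n0 by (simp add: add_pos_pos)
  have "S\<^sup>2 / n \<le> S2" using supp n0 by (simp add: field_simps)
  then have "\<alpha> * (2 * S)\<^sup>2 \<le> 2 * M * (2 * S) - M\<^sup>2 * (real m * (1 - \<epsilon>\<^sup>2))"
  proof -
    have "\<alpha> * (2 * S)\<^sup>2 = 4 * S\<^sup>2 / M + 2 * (S\<^sup>2 / n)"
      by (simp add: \<alpha>_def distrib_right power_mult_distrib)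
    then show ?thesis using main \<open>S\<^sup>2 / n \<le> S2\<close> by linarith
  qed
  then have "\<alpha> * (\<alpha> * (2 * S)\<^sup>2) \<le> \<alpha> * (2 * M * (2 * S) - M\<^sup>2 * (real m * (1 - \<epsilon>\<^sup>2)))"
    using \<alpha> by (intro mult_left_mono) auto
  moreover have "0 \<le> (\<alpha> * (2 * S) - M)\<^sup>2" by simp
  ultimately have "M\<^sup>2 * (\<alpha> * (real m * (1 - \<epsilon>\<^sup>2))) \<le> M\<^sup>2 * 1"
    by (simp add: power2_eq_square algebra_simps)
  then have "\<alpha> * (real m * (1 - \<epsilon>\<^sup>2)) \<le> 1" using M by (simp add: mult_le_cancel_left)
  then have "(2 * n + M) * (real m * (1 - \<epsilon>\<^sup>2)) \<le> 2 * n * M"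
    using M n0 by (simp add: \<alpha>_def field_simps)
  then have "real m * M * (1 - \<epsilon>\<^sup>2) \<le> n * (2 * (1 + real m * \<epsilon>\<^sup>2))"
    by (simp add: M_def algebra_simps)
  then have "real m * M * (1 - \<epsilon>\<^sup>2) / (2 * (1 + real m * \<epsilon>\<^sup>2)) \<le> n"
    using assms(1) by (simp add: pos_divide_le_eq add_pos_nonneg)
  then show ?thesis by (simp add: n_def M_def)
qed

text \<open>The value on the edge \<open>(j, i)\<close> of the difference of the potential that is \<open>1\<close> at the vertex \<open>k\<close>
  and \<open>0\<close> elsewhere.  Only the vertices \<open>k < m\<close> are used as indices; since constant potentials
  have no differences, the potential may be taken to vanish at the vertex \<open>m\<close>.\<close>

definition edge_fun :: "nat \<Rightarrow> nat \<times> nat \<Rightarrow> complex" where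
  "edge_fun k = (\<lambda>(j, i). (if k = j then 1 else 0) - (if k = i then 1 else 0))"

lemma lin_comb_edge_fun:
  "lin_comb m edge_fun c (j, i) = (if j < m then c j else 0) - (if i < m then c i else 0)"
proof -
  have "lin_comb m edge_fun c (j, i) = (\<Sum>k<m. (if k = j then c k else 0) - (if k = i then c k else 0))"
    unfolding lin_comb_def edge_fun_def by (intro sum.cong) auto
  then show ?thesis by (simp add: sum_subtractf)
qed

lemma edge_fun_indep: "lin_indep_on (edge_pairs m) m edge_fun"
  unfolding lin_indep_on_def
proof (intro allI impI)
  fix c k assume "\<forall>p\<in>edge_pairs m. lin_comb m edge_fun c p = 0" "k < m"
  then have "lin_comb m edge_fun c (m, k) = 0" by (simp add: edge_pairs_def)
  then show "c k = 0" using \<open>k < m\<close> by (simp add: lin_comb_edge_fun)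
qed

lemma edge_fun_sparsifier:
  assumes "0 < \<epsilon>" "\<epsilon> < 1" "0 < m" "discrete_MZ (edge_pairs m) m edge_fun \<epsilon> W"
  shows "real m * (real m + 1) * (1 - \<epsilon>\<^sup>2) / (2 * (1 + real m * \<epsilon>\<^sup>2)) \<le> real (card {p \<in> edge_pairs m. 0 < W p})"
proof (rule complete_graph_sparsifier[OF assms(1-3)])
  show "0 \<le> W p" if "p \<in> edge_pairs m" for p using assms(4) that by (simp add: discrete_MZ_def)
  fix y :: "nat \<Rightarrow> real"
  \<comment> \<open>Subtracting a constant makes the potential vanish at the vertex \<open>m\<close>.\<close>
  define c where "c k = complex_of_real (y k - y m)" for k
  have c: "(cmod (lin_comb m edge_fun c (j, i)))\<^sup>2 = (y j - y i)\<^sup>2" if "(j, i) \<in> edge_pairs m" for i j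
  proof -
    have "lin_comb m edge_fun c (j, i) = of_real (y j - y i)"
      using that unfolding lin_comb_edge_fun edge_pairs_def c_def by (cases "j = m") auto
    then show ?thesis by (simp only: norm_of_real power2_abs)
  qed
  have eqs: "(\<Sum>p\<in>edge_pairs m. (cmod (lin_comb m edge_fun c p))\<^sup>2) = (\<Sum>(j, i)\<in>edge_pairs m. (y j - y i)\<^sup>2)"
    "(\<Sum>p\<in>edge_pairs m. W p * (cmod (lin_comb m edge_fun c p))\<^sup>2) = (\<Sum>(j, i)\<in>edge_pairs m. W (j, i) * (y j - y i)\<^sup>2)"
    by (auto intro!: sum.cong simp: c)
  have "(1 - \<epsilon>) * (\<Sum>p\<in>edge_pairs m. (cmod (lin_comb m edge_fun c p))\<^sup>2)
        \<le> (\<Sum>p\<in>edge_pairs m. W p * (cmod (lin_comb m edge_fun c p))\<^sup>2)"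
    "(\<Sum>p\<in>edge_pairs m. W p * (cmod (lin_comb m edge_fun c p))\<^sup>2)
        \<le> (1 + \<epsilon>) * (\<Sum>p\<in>edge_pairs m. (cmod (lin_comb m edge_fun c p))\<^sup>2)"
    using assms(4) unfolding discrete_MZ_def by blast+
  then show "(1 - \<epsilon>) * (\<Sum>(j, i)\<in>edge_pairs m. (y j - y i)\<^sup>2) \<le> (\<Sum>(j, i)\<in>edge_pairs m. W (j, i) * (y j - y i)\<^sup>2)"
    "(\<Sum>(j, i)\<in>edge_pairs m. W (j, i) * (y j - y i)\<^sup>2) \<le> (1 + \<epsilon>) * (\<Sum>(j, i)\<in>edge_pairs m. (y j - y i)\<^sup>2)"
    unfolding eqs .
qed

section \<open>Bounds for the number of points\<close>

lemma MZ_number_lower: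
  assumes "infinite (UNIV :: 'a set)" "0 < \<epsilon>" "\<epsilon> < 1" "0 < m"
  shows "ereal (max (real m) (real m * (real m + 1) * (1 - \<epsilon>\<^sup>2) / (2 * (1 + real m * \<epsilon>\<^sup>2))))
    \<le> ereal_of_enat (MZ_number TYPE('a) m \<epsilon>)"
proof -
  define B where "B = max (real m) (real m * (real m + 1) * (1 - \<epsilon>\<^sup>2) / (2 * (1 + real m * \<epsilon>\<^sup>2)))"
  have fin: "finite (edge_pairs m)" by (simp add: edge_pairs_def)
  have "enat (nat \<lceil>B\<rceil>) \<le> MZ_number TYPE('a) m \<epsilon>"
  proof (rule MZ_number_ge[OF assms(1) fin edge_fun_indep])
    fix W assume W: "discrete_MZ (edge_pairs m) m edge_fun \<epsilon> W"
    have "B \<le> real (card {p \<in> edge_pairs m. 0 < W p})"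
      unfolding B_def using edge_fun_sparsifier[OF assms(2-4) W]
        discrete_MZ_card_ge[OF fin edge_fun_indep W assms(3)] by simp
    then show "nat \<lceil>B\<rceil> \<le> card {p \<in> edge_pairs m. 0 < W p}" by (simp add: nat_le_iff ceiling_le_iff)
  qed
  then have "ereal_of_enat (enat (nat \<lceil>B\<rceil>)) \<le> ereal_of_enat (MZ_number TYPE('a) m \<epsilon>)"
    by (simp only: ereal_of_enat_le_iff)
  moreover have "ereal B \<le> ereal_of_enat (enat (nat \<lceil>B\<rceil>))" by (simp add: real_nat_ceiling_ge)
  ultimately show ?thesis unfolding B_def by (rule order_trans[rotated])
qed

lemma MZ_number_le_square: "0 \<le> \<epsilon> \<Longrightarrow> MZ_number TYPE('a) m \<epsilon> \<le> enat (m\<^sup>2)"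
  by (rule MZ_number_le) (rule MZ_positive_square)

lemma MZ_number_upper:
  assumes "0 < \<epsilon>" "\<epsilon> < 1" "0 < m"
  shows "ereal_of_enat (MZ_number TYPE('a) m \<epsilon>) \<le> ereal (min ((real m)\<^sup>2) (5 * real m / \<epsilon>\<^sup>2))"
proof -
  define N where "N = nat \<lceil>4 * real m / \<epsilon>\<^sup>2\<rceil>"
  have "MZ_number TYPE('a) m \<epsilon> \<le> enat N"
  proof (rule MZ_number_le)
    fix M :: "'a measure" and F assume MF: "L2_function_space M m F"
    show "\<exists>n\<le>N. MZ_positive M F n \<epsilon>"
      by (rule MZ_positive_sparse[OF MF _ assms]) (use assms in \<open>simp_all add: N_def real_nat_ceiling_ge\<close>)
  qed
  then have "ereal_of_enat (MZ_number TYPE('a) m \<epsilon>) \<le> ereal_of_enat (enat N)"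
    by (simp only: ereal_of_enat_le_iff)
  also have "\<dots> \<le> ereal (5 * real m / \<epsilon>\<^sup>2)"
  proof -
    have "\<epsilon>\<^sup>2 \<le> 1\<^sup>2" using assms by (intro power_mono) auto
    also have "1\<^sup>2 \<le> real m" using assms(3) by simp
    finally have "1 \<le> real m / \<epsilon>\<^sup>2" using assms(1) by simp
    moreover have "real N \<le> 4 * real m / \<epsilon>\<^sup>2 + 1"
    proof -
      have "0 \<le> 4 * real m / \<epsilon>\<^sup>2" by simp
      then have "real N = of_int \<lceil>4 * real m / \<epsilon>\<^sup>2\<rceil>" unfolding N_def by (intro of_nat_nat) linarith
      then show ?thesis using of_int_ceiling_le_add_one[of "4 * real m / \<epsilon>\<^sup>2"] by simp
    qed
    moreover have "5 * real m / \<epsilon>\<^sup>2 = 4 * real m / \<epsilon>\<^sup>2 + real m / \<epsilon>\<^sup>2"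
      by (simp add: add_divide_distrib[symmetric])
    ultimately show ?thesis by simp
  qed
  finally have "ereal_of_enat (MZ_number TYPE('a) m \<epsilon>) \<le> ereal (5 * real m / \<epsilon>\<^sup>2)" .
  moreover have "ereal_of_enat (MZ_number TYPE('a) m \<epsilon>) \<le> ereal_of_enat (enat (m\<^sup>2))"
    using MZ_number_le_square[where 'a = 'a, of \<epsilon> m] assms(1) by (simp only: ereal_of_enat_le_iff less_imp_le)
  ultimately show ?thesis by (simp add: min_def)
qed

lemma MZ_number_exact:
  assumes "infinite (UNIV :: 'a set)"
  shows "MZ_number TYPE('a) m 0 = enat (m\<^sup>2)"
proof (rule antisym)
  show "MZ_number TYPE('a) m 0 \<le> enat (m\<^sup>2)" by (rule MZ_number_le_square) simp
  show "enat (m\<^sup>2) \<le> MZ_number TYPE('a) m 0"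
    by (rule MZ_number_ge[OF assms _ tomography_indep tomography_exact]) simp
qed

text \<open>The bound \<open>m\<close> suffices for \<open>\<epsilon>\<^sup>2 \<ge> 1 / 8\<close>; for smaller \<open>\<epsilon>\<close> the second term is
  estimated separately for \<open>m \<epsilon>\<^sup>2 \<le> 1\<close> and \<open>m \<epsilon>\<^sup>2 \<ge> 1\<close>.\<close>

lemma lower_bound_arithmetic:
  fixes m :: nat and \<epsilon> :: real
  assumes "0 < \<epsilon>" "\<epsilon> < 1" "0 < m"
  shows "1 / 8 * min ((real m)\<^sup>2) (real m / \<epsilon>\<^sup>2)
    \<le> max (real m) (real m * (real m + 1) * (1 - \<epsilon>\<^sup>2) / (2 * (1 + real m * \<epsilon>\<^sup>2)))"
proof -
  define t where "t = \<epsilon>\<^sup>2"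
  have t: "0 < t" using assms by (simp add: t_def)
  define B where "B = real m * (real m + 1) * (1 - t) / (2 * (1 + real m * t))"
  have m1: "1 \<le> real m" using assms(3) by simp
  have d: "0 < 1 + real m * t" using t by (simp add: add_pos_nonneg)
  have frac: "a / 8 \<le> X / (2 * d)" if "a * d \<le> 4 * X" "0 < d" for a d X :: real
    using that by (simp add: field_simps)
  consider "1 / 8 \<le> t" | "t < 1 / 8" "real m * t \<le> 1" | "t < 1 / 8" "1 \<le> real m * t" by linarith
  then have "1 / 8 * min ((real m)\<^sup>2) (real m / t) \<le> max (real m) B"
  proof cases
    case 1
    then have "real m / t \<le> 8 * real m" using t m1 by (simp add: field_simps)
    then show ?thesis by (simp add: min_def max_def)
  next
    case 2
    have "(real m)\<^sup>2 * (1 + real m * t) \<le> (real m)\<^sup>2 * 2" using 2 by (intro mult_left_mono) auto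
    also have "\<dots> \<le> 4 * (real m * (real m + 1) * (1 - t))"
    proof -
      have "real m * (real m * (1 / 2)) \<le> real m * ((real m + 1) * (1 - t))"
        using 2 m1 by (intro mult_left_mono mult_mono) auto
      then have "(real m)\<^sup>2 / 2 \<le> real m * (real m + 1) * (1 - t)"
        by (simp add: power2_eq_square mult.assoc)
      then show ?thesis by linarith
    qed
    finally have "(real m)\<^sup>2 / 8 \<le> B" unfolding B_def by (rule frac[OF _ d])
    then show ?thesis by (simp add: min_def max_def)
  next
    case 3
    have "real m * (1 + real m * t) \<le> real m * (2 * (real m * t))" using 3 m1 by - (intro mult_left_mono; linarith)
    also have "\<dots> = 4 * t * (real m * (real m * (1 / 2)))" by simp
    also have "\<dots> \<le> 4 * t * (real m * ((real m + 1) * (1 - t)))"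
      using 3 t m1 by (intro mult_left_mono mult_mono) auto
    finally have "real m / t * (1 + real m * t) \<le> 4 * (real m * (real m + 1) * (1 - t))"
      using t by (simp add: pos_divide_le_eq mult.commute mult.left_commute)
    then have "real m / t / 8 \<le> B" unfolding B_def by (rule frac[OF _ d])
    then show ?thesis by (simp add: min_def max_def)
  qed
  then show ?thesis by (simp add: B_def t_def)
qed

theorem theorem1p1:
  fixes m :: nat
  assumes "infinite (UNIV :: 'a set)"
    and "2 \<le> m"
  shows "(\<forall>\<epsilon>::real. 0 < \<epsilon> \<and> \<epsilon> < 1 \<longrightarrow>
            ereal (max (real m) (real m * (real m + 1) * (1 - \<epsilon>\<^sup>2) / (2 * (1 + real m * \<epsilon>\<^sup>2))))
              \<le> ereal_of_enat (MZ_number TYPE('a) m \<epsilon>) \<and>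
            ereal_of_enat (MZ_number TYPE('a) m \<epsilon>)
              \<le> ereal (min ((real m)\<^sup>2) (5 * real m / \<epsilon>\<^sup>2)))
       \<and> MZ_number TYPE('a) m 0 = enat (m\<^sup>2)
       \<and> (\<forall>\<epsilon>::real. 0 < \<epsilon> \<and> \<epsilon> < 1 \<longrightarrow>
            ereal (1 / 8 * min ((real m)\<^sup>2) (real m / \<epsilon>\<^sup>2))
              \<le> ereal_of_enat (MZ_number TYPE('a) m \<epsilon>) \<and>
            ereal_of_enat (MZ_number TYPE('a) m \<epsilon>)
              \<le> ereal (5 * min ((real m)\<^sup>2) (real m / \<epsilon>\<^sup>2)))"
proof (intro conjI allI impI)
  have m: "0 < m" using assms(2) by simp
  show "MZ_number TYPE('a) m 0 = enat (m\<^sup>2)" by (rule MZ_number_exact[OF assms(1)])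
  fix \<epsilon> :: real assume "0 < \<epsilon> \<and> \<epsilon> < 1"
  then have \<epsilon>: "0 < \<epsilon>" "\<epsilon> < 1" by auto
  note lower = MZ_number_lower[OF assms(1) \<epsilon> m] and upper = MZ_number_upper[OF \<epsilon> m, where 'a = 'a]
  show "ereal (max (real m) (real m * (real m + 1) * (1 - \<epsilon>\<^sup>2) / (2 * (1 + real m * \<epsilon>\<^sup>2))))
      \<le> ereal_of_enat (MZ_number TYPE('a) m \<epsilon>)" by (rule lower)
  show "ereal_of_enat (MZ_number TYPE('a) m \<epsilon>) \<le> ereal (min ((real m)\<^sup>2) (5 * real m / \<epsilon>\<^sup>2))"
    by (rule upper)
  show "ereal (1 / 8 * min ((real m)\<^sup>2) (real m / \<epsilon>\<^sup>2)) \<le> ereal_of_enat (MZ_number TYPE('a) m \<epsilon>)"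
    by (rule order_trans[OF _ lower]) (simp only: ereal_less_eq(3) lower_bound_arithmetic[OF \<epsilon> m])
  have "min ((real m)\<^sup>2) (5 * real m / \<epsilon>\<^sup>2) \<le> 5 * min ((real m)\<^sup>2) (real m / \<epsilon>\<^sup>2)"
  proof -
    have "min a (5 * b) \<le> 5 * min a b" if "0 \<le> a" for a b :: real using that by (auto simp: min_def)
    from this[of "(real m)\<^sup>2" "real m / \<epsilon>\<^sup>2"] show ?thesis by simp
  qed
  then show "ereal_of_enat (MZ_number TYPE('a) m \<epsilon>) \<le> ereal (5 * min ((real m)\<^sup>2) (real m / \<epsilon>\<^sup>2))"
    by (intro order_trans[OF upper]) (simp only: ereal_less_eq(3))
qed

end
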